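(* Let $\Gamma=(V,E)$ be a connected finite simple graph on $N\geq 3$ vertices, and let $\varepsilon:=\min_i|1-\lambda_i|$, where $\lambda_1,\dots,\lambda_N$ are the eigenvalues of its normalized Laplacian. Then $\varepsilon\leq \frac12$. Moreover, $\varepsilon=\frac12$ if and only if $\Gamma$ is an $m$-petal graph for some $m\geq 1$ (this requires $N=2m+1$ odd) or an $m$-book graph for some $m\geq1$ (this requires $N=2m+2$ even).
   Context: For a finite simple graph $\Gamma=(V,E)$ without isolated vertices, $\deg v$ is the number of neighbours of $v$ and $\mathcal N(v)=\{w\in V: w\sim v\}$. The normalized Laplacian acts on functions $f:V\to\mathbb R$ by $\Delta f(v)=f(v)-\frac{1}{\deg v}\sum_{w\sim v}f(w)$; its eigenvalues are $0=\lambda_1\le\lambda_2\le\dots\le\lambda_N$, and $\varepsilon:=\min_i|1-\lambda_i|$. The $m$-petal graph ($m\ge1$) has vertex set $\{x,v_1,\dots,v_m,w_1,\dots,w_m\}$ and edges $\{x,v_i\},\{x,w_i\},\{v_i,w_i\}$ for $i=1,\dots,m$. The $m$-book graph ($m\ge1$) has vertex set $\{x,y,v_1,\dots,v_m,w_1,\dots,w_m\}$ and edges $\{x,v_i\},\{y,w_i\},\{v_i,w_i\}$ for $i=1,\dots,m$. *)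

theory Defs
  imports Main "HOL-Library.Cardinality" Complex_Main
begin

definition simple_graph :: "'a set \<Rightarrow> ('a \<Rightarrow> 'a \<Rightarrow> bool) \<Rightarrow> bool" where
  "simple_graph V E \<longleftrightarrow> finite V \<and> (\<forall>u v. E u v \<longrightarrow> u \<in> V \<and> v \<in> V)
     \<and> (\<forall>u v. E u v \<longrightarrow> E v u) \<and> (\<forall>u. \<not> E u u)"

definition graph_connected :: "'a set \<Rightarrow> ('a \<Rightarrow> 'a \<Rightarrow> bool) \<Rightarrow> bool" where
  "graph_connected V E \<longleftrightarrow> (\<forall>u\<in>V. \<forall>v\<in>V. E\<^sup>*\<^sup>* u v)"

definition nbrs :: "'a set \<Rightarrow> ('a \<Rightarrow> 'a \<Rightarrow> bool) \<Rightarrow> 'a \<Rightarrow> 'a set" where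
  "nbrs V E v = {w \<in> V. E v w}"

definition deg :: "'a set \<Rightarrow> ('a \<Rightarrow> 'a \<Rightarrow> bool) \<Rightarrow> 'a \<Rightarrow> nat" where
  "deg V E v = card (nbrs V E v)"

definition norm_lap :: "'a set \<Rightarrow> ('a \<Rightarrow> 'a \<Rightarrow> bool) \<Rightarrow> ('a \<Rightarrow> real) \<Rightarrow> 'a \<Rightarrow> real" where
  "norm_lap V E f v = f v - (\<Sum>w\<in>nbrs V E v. f w) / real (deg V E v)"

definition nlap_eigenvalues :: "'a set \<Rightarrow> ('a \<Rightarrow> 'a \<Rightarrow> bool) \<Rightarrow> real set" where
  "nlap_eigenvalues V E = {\<mu>. \<exists>f. (\<exists>v\<in>V. f v \<noteq> 0) \<and> (\<forall>v\<in>V. norm_lap V E f v = \<mu> * f v)}"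

definition nlap_epsilon :: "'a set \<Rightarrow> ('a \<Rightarrow> 'a \<Rightarrow> bool) \<Rightarrow> real" where
  "nlap_epsilon V E = Min ((\<lambda>\<mu>. \<bar>1 - \<mu>\<bar>) ` nlap_eigenvalues V E)"

definition graph_iso :: "'a set \<Rightarrow> ('a \<Rightarrow> 'a \<Rightarrow> bool) \<Rightarrow> 'b set \<Rightarrow> ('b \<Rightarrow> 'b \<Rightarrow> bool) \<Rightarrow> bool" where
  "graph_iso V E V' E' \<longleftrightarrow> (\<exists>h. bij_betw h V V' \<and> (\<forall>u\<in>V. \<forall>v\<in>V. E u v \<longleftrightarrow> E' (h u) (h v)))"

text \<open>m-petal graph on {0..2m}: x = 0, v_i = i, w_i = m+i (1 \<le> i \<le> m).\<close>
definition petal_V :: "nat \<Rightarrow> nat set" where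
  "petal_V m = {0..2*m}"

definition petal_E :: "nat \<Rightarrow> nat \<Rightarrow> nat \<Rightarrow> bool" where
  "petal_E m a b \<longleftrightarrow>
     (a = 0 \<and> 1 \<le> b \<and> b \<le> 2*m) \<or> (b = 0 \<and> 1 \<le> a \<and> a \<le> 2*m) \<or>
     (\<exists>i. 1 \<le> i \<and> i \<le> m \<and> ((a = i \<and> b = m + i) \<or> (a = m + i \<and> b = i)))"

text \<open>m-book graph on {0..2m+1}: x = 0, y = 2m+1, v_i = i, w_i = m+i (1 \<le> i \<le> m).\<close>
definition book_V :: "nat \<Rightarrow> nat set" where
  "book_V m = {0..2*m+1}"

definition book_E :: "nat \<Rightarrow> nat \<Rightarrow> nat \<Rightarrow> bool" where
  "book_E m a b \<longleftrightarrow>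
     (\<exists>i. 1 \<le> i \<and> i \<le> m \<and>
        ((a = 0 \<and> b = i) \<or> (a = i \<and> b = 0) \<or>
         (a = 2*m+1 \<and> b = m+i) \<or> (a = m+i \<and> b = 2*m+1) \<or>
         (a = i \<and> b = m+i) \<or> (a = m+i \<and> b = i)))"

end

(*
  Idea. In the inner product weighted by the degrees, 1 - Laplacian is the averaging operator M, and
  all eigenvalues satisfy |1 - nu| >= 1/2 exactly if <Mf, Mf> >= <f, f>/4 for all f. Writing
  G p = (sum over neighbours x of p of 4/deg x - 1), the point mass at p gives G p >= 0, the
  difference of the point masses at two neighbours of w gives G p + G q >= 8/deg w, and test functions
  on a vertex and the leaves at distance two from it bound G from below near leaves. Since only
  neighbours of degree at most 3 contribute positively to G, these bounds clash unless there are two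
  adjacent vertices u, u' of degree 2. In that case suitable test functions on u, u' and their other
  neighbours force equality everywhere, and a function on which the form vanishes solves M^2 f = f/4.
  Evaluating this equation at every vertex leaves only petal and book graphs.
*)
theory Submission
  imports Defs "HOL-Analysis.Analysis"
begin

section \<open>The spectral gap as a quadratic inequality\<close>

text \<open>The spectrum reaches the quadratic form without an eigenbasis: compactness yields a
  minimiser \<open>f\<close> of the Rayleigh quotient, it satisfies M^2 f = \<rho> f, and (M - s)(M
  + s) f = 0 with s^2 = \<rho> produces an eigenvalue s or -s of M. Up to the factor 4,
  \<open>G\<close> is the diagonal of the matrix A D^-1 A - D/4 of the form (A adjacency, D
  degrees), so each test function probes a small principal block of a positive semidefinite matrix.
  The test functions at \<open>u\<close> and \<open>u'\<close> are null vectors of the extremal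
  graphs. On a petal graph with centre \<open>w\<close>, the one used is the M-eigenfunction for
  -1/2 with value -2 at \<open>w\<close> and 1 elsewhere, plus one for 1/2 that cancels it outside
  \<open>w\<close>, \<open>u\<close>, \<open>u'\<close>. Hence the bounds are sharp there and
  equality propagates. Leaves are the obstacle to excluding all other graphs: a leaf adds 3 to
  \<open>G\<close>, a vertex of degree 2 adds 1, of degree 3 adds 1/3. Plain degree counting works
  only after leaves, and with them degree 2, are ruled out.\<close>

lemma linear_term_zero:
  fixes b c :: real
  assumes "\<And>t. 2 * t * b + t\<^sup>2 * c \<ge> 0"
  shows "b = 0"
proof (rule ccontr)
  assume "b \<noteq> 0"
  \<comment> \<open>A step against the sign of \<open>b\<close>, so short that the linear term
    outweighs the quadratic one whatever \<open>c\<close> is.\<close>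
  define s where "s = - b / (1 + \<bar>c\<bar>)"
  have b: "b = - s * (1 + \<bar>c\<bar>)"
    unfolding s_def by (simp add: add_nonneg_eq_0_iff)
  then have "s \<noteq> 0" using \<open>b \<noteq> 0\<close> by auto
  have "2 * s * b + s\<^sup>2 * c = s\<^sup>2 * (c - 2 * (1 + \<bar>c\<bar>))"
    unfolding b by (simp add: algebra_simps power2_eq_square)
  also have "\<dots> < 0"
    using \<open>s \<noteq> 0\<close> by (intro mult_pos_neg) auto
  finally show False using assms[of s] by simp
qed

locale connected_graph =
  fixes V :: "'a set" and E :: "'a \<Rightarrow> 'a \<Rightarrow> bool"
  assumes simple: "simple_graph V E"
    and connected: "graph_connected V E"
    and card_V: "card V \<ge> 3"
begin

abbreviation N :: "'a \<Rightarrow> 'a set" where "N \<equiv> nbrs V E"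
abbreviation d :: "'a \<Rightarrow> real" where "d v \<equiv> real (deg V E v)"

lemma finite_V: "finite V"
  using simple by (simp add: simple_graph_def)

lemma mem_nbrs: "w \<in> N v \<longleftrightarrow> E v w"
  using simple by (auto simp: nbrs_def simple_graph_def)

lemma nbrs_sym: "w \<in> N v \<longleftrightarrow> v \<in> N w"
  using simple by (auto simp: mem_nbrs simple_graph_def)

lemma nbrs_symD: "w \<in> N v \<Longrightarrow> v \<in> N w"
  using nbrs_sym by simp

lemma not_self_nbr: "v \<notin> N v"
  using simple by (auto simp: mem_nbrs simple_graph_def)

lemma nbrs_subset: "N v \<subseteq> V"
  by (auto simp: nbrs_def)

lemma nbr_in_V: "w \<in> N v \<Longrightarrow> w \<in> V" "w \<in> N v \<Longrightarrow> v \<in> V"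
  using nbrs_subset nbrs_sym by blast+

lemma finite_nbrs: "finite (N v)"
  using finite_V nbrs_subset finite_subset by blast

text \<open>Connectedness as an induction principle. It serves to show that a local configuration
  already exhausts the graph.\<close>

lemma closed_subset_eq_V:
  assumes "v \<in> S" "v \<in> V" and "\<And>u w. u \<in> S \<Longrightarrow> w \<in> N u \<Longrightarrow> w \<in> S"
  shows "V \<subseteq> S"
proof
  fix w assume "w \<in> V"
  then have "E\<^sup>*\<^sup>* v w"
    using connected assms(2) by (auto simp: graph_connected_def)
  then show "w \<in> S"
    by (induction rule: rtranclp_induct) (use assms mem_nbrs in auto)
qed

lemma deg_ge_1: assumes "v \<in> V" shows "deg V E v \<ge> 1"
proof (rule ccontr)
  assume "\<not> ?thesis"
  then have "N v = {}"
    using finite_nbrs by (auto simp: deg_def not_le)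
  then have "V \<subseteq> {v}"
    using closed_subset_eq_V[of v "{v}"] assms by auto
  then have "card V \<le> 1"
    using card_mono[of "{v}" V] by simp
  then show False using card_V by simp
qed

lemma d_ge_1: "v \<in> V \<Longrightarrow> d v \<ge> 1"
  using deg_ge_1 by fastforce

lemma d_pos: "v \<in> V \<Longrightarrow> d v > 0"
  using d_ge_1 by fastforce

text \<open>With \<open>M\<close> the averaging operator, \<open>ip\<close> is the degree-weighted inner product and
  \<open>bilin f g\<close> is \<open>ip (M f) (M g)\<close>.\<close>

definition bilin :: "('a \<Rightarrow> real) \<Rightarrow> ('a \<Rightarrow> real) \<Rightarrow> real" where
  "bilin f g = (\<Sum>y\<in>V. (\<Sum>x\<in>N y. f x) * (\<Sum>x\<in>N y. g x) / d y)"

definition ip :: "('a \<Rightarrow> real) \<Rightarrow> ('a \<Rightarrow> real) \<Rightarrow> real" where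
  "ip f g = (\<Sum>y\<in>V. d y * f y * g y)"

text \<open>Symmetry of adjacency. In the degree-weighted product this says that the averaging
  operator M is self-adjoint, the weights having cancelled the denominators.\<close>

lemma sum_nbrs_swap:
  "(\<Sum>y\<in>V. g y * (\<Sum>x\<in>N y. f x)) = (\<Sum>y\<in>V. f y * (\<Sum>x\<in>N y. g x))"
  for f g :: "'a \<Rightarrow> real"
proof -
  have *: "(\<Sum>y\<in>V. g y * (\<Sum>x\<in>N y. f x)) = (\<Sum>y\<in>V. \<Sum>x\<in>V. if E y x then g y * f x else 0)"
    for f g :: "'a \<Rightarrow> real"
    unfolding sum_distrib_left
    unfolding nbrs_def by (intro sum.cong refl sum.inter_filter finite_V)
  have "(\<Sum>y\<in>V. g y * (\<Sum>x\<in>N y. f x)) = (\<Sum>x\<in>V. \<Sum>y\<in>V. if E y x then g y * f x else 0)"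
    unfolding * by (rule sum.swap)
  also have "\<dots> = (\<Sum>y\<in>V. f y * (\<Sum>x\<in>N y. g x))"
    unfolding * by (intro sum.cong refl) (use nbrs_sym mem_nbrs in auto)
  finally show ?thesis .
qed

text \<open>Self-adjointness turns <M f, M g> into <M^2 f, g>; the weight at \<open>x\<close>
  cancels the denominator of the outer average.\<close>

lemma bilin_eq_ip_two_steps:
  "bilin f g = (\<Sum>x\<in>V. g x * (\<Sum>y\<in>N x. (\<Sum>z\<in>N y. f z) / d y))"
  unfolding bilin_def by (subst sum_nbrs_swap[symmetric]) (simp add: mult.commute)

lemma bilin_expand: "bilin (\<lambda>x. f x + t * g x) (\<lambda>x. f x + t * g x)
    = bilin f f + 2 * t * bilin f g + t\<^sup>2 * bilin g g"
proof -
  have "(\<Sum>x\<in>N y. f x + t * g x) * (\<Sum>x\<in>N y. f x + t * g x) / d y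
      = (\<Sum>x\<in>N y. f x) * (\<Sum>x\<in>N y. f x) / d y + 2 * t * ((\<Sum>x\<in>N y. f x) * (\<Sum>x\<in>N y. g x) / d y)
        + t\<^sup>2 * ((\<Sum>x\<in>N y. g x) * (\<Sum>x\<in>N y. g x) / d y)" for y
    by (simp add: sum.distrib sum_distrib_left[symmetric] algebra_simps add_divide_distrib power2_eq_square)
  then show ?thesis
    unfolding bilin_def by (simp add: sum.distrib sum_distrib_left)
qed

lemma ip_expand: "ip (\<lambda>x. f x + t * g x) (\<lambda>x. f x + t * g x)
    = ip f f + 2 * t * ip f g + t\<^sup>2 * ip g g"
  unfolding ip_def
  by (simp add: sum_distrib_left sum.distrib[symmetric])
     (intro sum.cong refl, simp add: field_simps power2_eq_square)

text \<open>First variation towards the point mass at \<open>x\<close>: the form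
  \<open>bilin\<close> minus \<open>\<rho>\<close> times \<open>ip\<close> is nonnegative and
  vanishes at \<open>f\<close>, so its linear term there is zero. The result is M^2 f = \<rho> f at
  \<open>x\<close>, multiplied by \<open>d x\<close>.\<close>

lemma minimiser_equation:
  assumes lower: "\<And>g. bilin g g \<ge> \<rho> * ip g g" and eq: "bilin f f = \<rho> * ip f f" and "x \<in> V"
  shows "(\<Sum>y\<in>N x. (\<Sum>z\<in>N y. f z) / d y) = \<rho> * d x * f x"
proof -
  define g where "g = (\<lambda>z. if z = x then 1 else 0 :: real)"
  have "2 * t * (bilin f g - \<rho> * ip f g) + t\<^sup>2 * (bilin g g - \<rho> * ip g g) \<ge> 0" for t
    using lower[of "\<lambda>x. f x + t * g x"] eq unfolding bilin_expand ip_expand by (simp add: algebra_simps)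
  then have "bilin f g = \<rho> * ip f g"
    using linear_term_zero by fastforce
  moreover have "bilin f g = (\<Sum>y\<in>N x. (\<Sum>z\<in>N y. f z) / d y)"
    unfolding bilin_eq_ip_two_steps g_def using finite_V \<open>x \<in> V\<close>
    by (simp add: if_distrib[of "\<lambda>a. a * _"] cong: if_cong)
  moreover have "ip f g = d x * f x"
    unfolding ip_def g_def using finite_V \<open>x \<in> V\<close>
    by (simp add: if_distrib[of "\<lambda>a. _ * a"] cong: if_cong)
  ultimately show ?thesis by simp
qed

lemma ip_nonneg: "ip f f \<ge> 0"
  unfolding ip_def by (intro sum_nonneg) (simp add: mult.assoc)

lemma ip_zero_iff: "ip f f = 0 \<longleftrightarrow> (\<forall>v\<in>V. f v = 0)"
  unfolding ip_def using finite_V d_pos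
  by (subst sum_nonneg_eq_0_iff) (auto simp: mult.assoc, metis less_irrefl)

lemma bilin_scale: "bilin (\<lambda>x. c * f x) (\<lambda>x. c * f x) = c\<^sup>2 * bilin f f"
  unfolding bilin_def sum_distrib_left[symmetric]
  by (simp add: sum_distrib_left) (intro sum.cong refl, simp add: sum_distrib_left[symmetric] power2_eq_square)

lemma ip_scale: "ip (\<lambda>x. c * f x) (\<lambda>x. c * f x) = c\<^sup>2 * ip f f"
  unfolding ip_def by (simp add: sum_distrib_left power2_eq_square mult_ac)

lemma bilin_cong:
  assumes "\<And>x. x \<in> V \<Longrightarrow> f x = f' x"
  shows "bilin f f = bilin f' f'"
proof -
  have "(\<Sum>x\<in>N y. f x) = (\<Sum>x\<in>N y. f' x)" for y
    using assms nbrs_subset by (intro sum.cong) auto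
  then show ?thesis by (simp add: bilin_def)
qed

lemma ip_cong: "(\<And>x. x \<in> V \<Longrightarrow> f x = f' x) \<Longrightarrow> ip f f = ip f' f'"
  unfolding ip_def by (intro sum.cong refl) auto

text \<open>\<open>bilin\<close> attains its minimum on the compact unit sphere of
  \<open>ip\<close>; scaling carries the bound to all functions.\<close>

lemma Rayleigh_minimiser:
  obtains f \<rho> where "\<exists>v\<in>V. f v \<noteq> 0" "bilin f f = \<rho> * ip f f" "\<And>g. bilin g g \<ge> \<rho> * ip g g"
proof -
  \<comment> \<open>The vertex type may be infinite, so functions are pinned to 0 outside
    \<open>V\<close>. The box is then compact as a product, and since degrees are at least 1 it
    contains every normalised function.\<close>
  define B where "B = PiE UNIV (\<lambda>v. if v \<in> V then {-1..1} else {0::real})"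
  define K where "K = B \<inter> {f. ip f f = 1}"
  have cont_ip: "continuous_on UNIV (\<lambda>f. ip f f)"
    unfolding ip_def by (intro continuous_intros continuous_on_product_coordinates)
  have cont_bilin: "continuous_on UNIV (\<lambda>f. bilin f f)"
    unfolding bilin_def divide_inverse
    by (intro continuous_intros continuous_on_product_coordinates)
  have "compactin (product_topology (\<lambda>_. euclidean) UNIV) B"
    unfolding B_def by (subst compactin_PiE) auto
  then have "compact B"
    by (simp add: euclidean_product_topology)
  moreover have "closed {f. ip f f = 1}"
    by (intro closed_Collect_eq cont_ip continuous_on_const)
  ultimately have "compact K"
    unfolding K_def by (rule compact_Int_closed)
  have normalise: "(\<lambda>x. if x \<in> V then g x / sqrt (ip g g) else 0) \<in> K"
    if "ip g g \<noteq> 0" for g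
  proof -
    define h where "h = (\<lambda>x. if x \<in> V then g x / sqrt (ip g g) else 0)"
    have pos: "ip g g > 0" using that ip_nonneg[of g] by linarith
    have "ip h h = ip (\<lambda>x. (1 / sqrt (ip g g)) * g x) (\<lambda>x. (1 / sqrt (ip g g)) * g x)"
      by (rule ip_cong) (simp add: h_def)
    also have "\<dots> = 1"
      unfolding ip_scale using pos by (simp add: power_divide)
    finally have 1: "ip h h = 1" .
    have "\<bar>h v\<bar> \<le> 1" if "v \<in> V" for v
    proof -
      have "(h v)\<^sup>2 \<le> d v * h v * h v"
        using d_ge_1[OF that] mult_right_mono[of 1 "d v" "(h v)\<^sup>2"]
        by (simp add: power2_eq_square mult.assoc)
      also have "\<dots> \<le> ip h h"
        unfolding ip_def using finite_V that
        by (intro member_le_sum[of v V "\<lambda>y. d y * h y * h y"]) (auto simp: mult.assoc)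
      finally show ?thesis using 1 by (simp add: abs_square_le_1)
    qed
    then have "h v \<in> {-1..1}" if "v \<in> V" for v
      using that by (fastforce simp: abs_le_iff)
    moreover have "h v = 0" if "v \<notin> V" for v
      using that by (simp add: h_def)
    ultimately have "h \<in> B"
      unfolding B_def by auto
    then show ?thesis using 1 unfolding K_def h_def by simp
  qed
  obtain v0 where "v0 \<in> V" using card_V by fastforce
  have "ip (\<lambda>_. 1) (\<lambda>_. 1) \<noteq> 0"
    using \<open>v0 \<in> V\<close> by (subst ip_zero_iff) auto
  from normalise[OF this] have "K \<noteq> {}" by auto
  moreover have "continuous_on K (\<lambda>f. bilin f f)"
    using cont_bilin by (rule continuous_on_subset) simp
  ultimately obtain f where f: "f \<in> K" "\<And>g. g \<in> K \<Longrightarrow> bilin f f \<le> bilin g g"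
    using continuous_attains_inf[OF \<open>compact K\<close>, of "\<lambda>f. bilin f f"] by auto
  have "ip f f = 1" using f(1) by (simp add: K_def)
  show ?thesis
  proof
    show "\<exists>v\<in>V. f v \<noteq> 0" using \<open>ip f f = 1\<close> ip_zero_iff[of f] by auto
    show "bilin f f = bilin f f * ip f f" using \<open>ip f f = 1\<close> by simp
    fix g
    show "bilin f f * ip g g \<le> bilin g g"
    proof (cases "ip g g = 0")
      case True
      then have "bilin g g = bilin (\<lambda>_. 0) (\<lambda>_. 0)"
        by (intro bilin_cong) (simp add: ip_zero_iff)
      then show ?thesis using True by (simp add: bilin_def)
    next
      case False
      then have pos: "ip g g > 0" using ip_nonneg[of g] by linarith
      have "bilin f f \<le> bilin (\<lambda>x. if x \<in> V then g x / sqrt (ip g g) else 0)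
          (\<lambda>x. if x \<in> V then g x / sqrt (ip g g) else 0)"
        using f(2) normalise[OF False] by blast
      also have "\<dots> = bilin (\<lambda>x. (1 / sqrt (ip g g)) * g x) (\<lambda>x. (1 / sqrt (ip g g)) * g x)"
        by (rule bilin_cong) simp
      also have "\<dots> = bilin g g / ip g g"
        unfolding bilin_scale using pos by (simp add: power_divide)
      finally show ?thesis using pos by (simp add: field_simps)
    qed
  qed
qed

lemma norm_lap_eigen_iff:
  "v \<in> V \<Longrightarrow> norm_lap V E f v = (1 - \<mu>) * f v \<longleftrightarrow> (\<Sum>w\<in>N v. f w) = \<mu> * d v * f v"
  using d_pos[of v] by (auto simp: norm_lap_def field_simps)

lemma spectral_gap_form_nonneg:
  assumes gap: "\<And>\<nu>. \<nu> \<in> nlap_eigenvalues V E \<Longrightarrow> \<bar>1 - \<nu>\<bar> \<ge> 1/2"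
  shows "bilin g g \<ge> 1/4 * ip g g"
proof -
  obtain f \<rho> where f: "\<exists>v\<in>V. f v \<noteq> 0" "bilin f f = \<rho> * ip f f"
    and lower: "\<And>g. bilin g g \<ge> \<rho> * ip g g"
    by (rule Rayleigh_minimiser) blast
  have two: "(\<Sum>y\<in>N x. (\<Sum>z\<in>N y. f z) / d y) = \<rho> * d x * f x" if "x \<in> V" for x
    using minimiser_equation[OF lower f(2) that] .
  have "ip f f > 0"
    using f(1) ip_zero_iff[of f] ip_nonneg[of f] by force
  moreover have "bilin f f \<ge> 0"
    unfolding bilin_def by (intro sum_nonneg) simp
  ultimately have "\<rho> \<ge> 0"
    using f(2) by (simp add: zero_le_mult_iff)
  define s where "s = sqrt \<rho>"
  have s: "s \<ge> 0" "s * s = \<rho>" using \<open>\<rho> \<ge> 0\<close> by (auto simp: s_def)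
  \<comment> \<open>This is M f + s f. From M^2 f = s^2 f follows M u = s u; if \<open>u\<close>
    vanishes on \<open>V\<close>, then M f = -s f. Either way the gap applies to an eigenvalue 1 - s
    or 1 + s of the Laplacian.\<close>
  define u where "u = (\<lambda>v. (\<Sum>w\<in>N v. f w) / d v + s * f v)"
  have "s \<ge> 1/2"
  proof (cases "\<exists>v\<in>V. u v \<noteq> 0")
    case True
    have "(\<Sum>w\<in>N v. u w) = s * d v * u v" if "v \<in> V" for v
      using two[OF that] d_pos[OF that] s(2)[symmetric]
      by (simp add: u_def sum.distrib sum_distrib_left[symmetric] field_simps)
    then have "1 - s \<in> nlap_eigenvalues V E"
      using True by (auto simp: nlap_eigenvalues_def norm_lap_eigen_iff intro!: exI[of _ u])
    then show ?thesis using gap s(1) by fastforce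
  next
    case False
    then have "(\<Sum>w\<in>N v. f w) = (- s) * d v * f v" if "v \<in> V" for v
      using that d_pos[OF that] by (force simp: u_def field_simps)
    then have "1 - (- s) \<in> nlap_eigenvalues V E"
      unfolding nlap_eigenvalues_def using f(1) norm_lap_eigen_iff[of _ f "- s"] by blast
    then show ?thesis using gap[of "1 - (- s)"] s(1) by simp
  qed
  then have "\<rho> \<ge> 1/4"
    using s mult_mono[of "1/2" s "1/2" s] by simp
  then show ?thesis
    using lower[of g] mult_right_mono[of "1/4" \<rho> "ip g g"] ip_nonneg[of g] by linarith
qed

end

section \<open>Local consequences of the gap\<close>

locale gapped_graph = connected_graph +
  assumes form_nonneg: "bilin g g \<ge> 1/4 * ip g g"
begin

text \<open>Entry of A D^-1 A, that is, \<open>bilin\<close> of the point masses at \<open>p\<close>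
  and \<open>q\<close>.\<close>

definition common :: "'a \<Rightarrow> 'a \<Rightarrow> real" where
  "common p q = (\<Sum>y\<in>N p \<inter> N q. 1 / d y)"

text \<open>Entry of A D^-1 A - D/4, the matrix of \<open>bilin\<close> minus a quarter of
  \<open>ip\<close>.\<close>

definition kap :: "'a \<Rightarrow> 'a \<Rightarrow> real" where
  "kap p q = common p q - (if p = q then d p / 4 else 0)"

text \<open>Four times the diagonal entry, with the degree of \<open>p\<close> spread evenly over
  its neighbours so that each has a weight of its own, positive exactly for degree at most
  3.\<close>

definition G :: "'a \<Rightarrow> real" where
  "G p = (\<Sum>x\<in>N p. 4 / d x - 1)"

lemma kap_diag: "kap p p = G p / 4"
  unfolding kap_def common_def G_def
  by (simp add: sum_subtractf sum_distrib_left deg_def diff_divide_distrib sum_divide_distrib)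

lemma common_sym: "common p q = common q p"
  by (simp add: common_def Int_commute)

lemma kap_sym: "kap p q = kap q p"
  by (simp add: kap_def common_sym)

lemma common_ge: assumes "w \<in> N p" "w \<in> N q" shows "common p q \<ge> 1 / d w"
  unfolding common_def using assms finite_nbrs
  by (intro member_le_sum[of w "N p \<inter> N q" "\<lambda>y. 1 / d y"]) auto

lemma two_steps_common:
  assumes "T \<subseteq> V" and "\<And>z. z \<in> V - T \<Longrightarrow> f z = 0"
  shows "(\<Sum>y\<in>N x. (\<Sum>z\<in>N y. f z) / d y) = (\<Sum>z\<in>T. f z * common z x)"
proof -
  have "(\<Sum>z\<in>T. f z * common z x) = (\<Sum>z\<in>V. f z * common z x)"
    using assms finite_V by (intro sum.mono_neutral_left) auto
  also have "\<dots> = (\<Sum>z\<in>V. \<Sum>y\<in>N x. if z \<in> N y then f z / d y else 0)"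
  proof (intro sum.cong refl)
    fix z
    have "f z * common z x = (\<Sum>y\<in>N z \<inter> N x. f z / d y)"
      by (simp add: common_def sum_distrib_left)
    also have "N z \<inter> N x = {y \<in> N x. z \<in> N y}"
      using nbrs_sym by blast
    also have "(\<Sum>y\<in>{y \<in> N x. z \<in> N y}. f z / d y) = (\<Sum>y\<in>N x. if z \<in> N y then f z / d y else 0)"
      using finite_nbrs by (rule sum.inter_filter)
    finally show "f z * common z x = (\<Sum>y\<in>N x. if z \<in> N y then f z / d y else 0)" .
  qed
  also have "\<dots> = (\<Sum>y\<in>N x. \<Sum>z\<in>V. if z \<in> N y then f z / d y else 0)"
    by (rule sum.swap)
  also have "\<dots> = (\<Sum>y\<in>N x. (\<Sum>z\<in>N y. f z) / d y)"
  proof (intro sum.cong refl)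
    fix y
    have "(\<Sum>z\<in>V. if z \<in> N y then f z / d y else 0) = (\<Sum>z\<in>{z\<in>V. z \<in> N y}. f z / d y)"
      using finite_V by (rule sum.inter_filter[symmetric])
    also have "{z\<in>V. z \<in> N y} = N y" using nbrs_subset by auto
    finally show "(\<Sum>z\<in>V. if z \<in> N y then f z / d y else 0) = (\<Sum>z\<in>N y. f z) / d y"
      by (simp add: sum_divide_distrib)
  qed
  finally show ?thesis ..
qed

lemma form_support:
  assumes "T \<subseteq> V" and "\<And>z. z \<in> V - T \<Longrightarrow> f z = 0"
  shows "bilin f f - 1/4 * ip f f = (\<Sum>p\<in>T. \<Sum>q\<in>T. f p * f q * kap p q)"
proof -
  have fin: "finite T" using assms(1) finite_V finite_subset by blast
  have "(\<Sum>y\<in>N x. (\<Sum>z\<in>N y. f z) / d y) = (\<Sum>z\<in>T. f z * common z x)" for x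
    using assms by (rule two_steps_common)
  then have "bilin f f = (\<Sum>x\<in>V. f x * (\<Sum>z\<in>T. f z * common z x))"
    unfolding bilin_eq_ip_two_steps by simp
  moreover have "1/4 * ip f f = (\<Sum>x\<in>V. f x * (d x * f x / 4))"
    unfolding ip_def sum_distrib_left by (intro sum.cong refl) simp
  ultimately have "bilin f f - 1/4 * ip f f = (\<Sum>x\<in>V. f x * ((\<Sum>z\<in>T. f z * common z x) - d x * f x / 4))"
    by (simp add: sum_subtractf right_diff_distrib)
  also have "\<dots> = (\<Sum>x\<in>T. f x * ((\<Sum>z\<in>T. f z * common z x) - d x * f x / 4))"
    using assms finite_V by (intro sum.mono_neutral_right) auto
  also have "\<dots> = (\<Sum>x\<in>T. \<Sum>z\<in>T. f x * f z * kap x z)"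
  proof (intro sum.cong refl)
    fix x assume "x \<in> T"
    have "(\<Sum>z\<in>T. f x * f z * kap x z)
        = (\<Sum>z\<in>T. f x * (f z * common z x)) - (\<Sum>z\<in>T. if x = z then f x * (d x * f x / 4) else 0)"
      unfolding sum_subtractf[symmetric] kap_def common_sym[of x]
      by (intro sum.cong refl) (auto simp: algebra_simps)
    then show "f x * ((\<Sum>z\<in>T. f z * common z x) - d x * f x / 4) = (\<Sum>z\<in>T. f x * f z * kap x z)"
      using fin \<open>x \<in> T\<close> by (simp add: sum_distrib_left right_diff_distrib)
  qed
  finally show ?thesis .
qed

lemma kap_form_nonneg:
  assumes "T \<subseteq> V"
  shows "(\<Sum>p\<in>T. \<Sum>q\<in>T. f p * f q * kap p q) \<ge> 0"
proof -
  have "(\<Sum>p\<in>T. \<Sum>q\<in>T. f p * f q * kap p q) = (\<Sum>p\<in>T. \<Sum>q\<in>T.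
      (if p \<in> T then f p else 0) * (if q \<in> T then f q else 0) * kap p q)"
    by (intro sum.cong refl) auto
  also have "\<dots> \<ge> 0"
    using form_support[OF assms, of "\<lambda>p. if p \<in> T then f p else 0"]
      form_nonneg[of "\<lambda>p. if p \<in> T then f p else 0"] by simp
  finally show ?thesis .
qed

text \<open>A null vector of a semidefinite form lies in its kernel. Outside \<open>T\<close> the
  vector is 0, so the diagonal part drops out of the kernel equation and only common neighbours
  remain. These equations spread the equality case over the graph.\<close>

lemma kap_form_kernel:
  assumes "T \<subseteq> V" and zero: "(\<Sum>p\<in>T. \<Sum>q\<in>T. f p * f q * kap p q) = 0" and "x \<in> V" "x \<notin> T"
  shows "(\<Sum>p\<in>T. f p * common p x) = 0"
proof -
  define g where "g = (\<lambda>p. if p \<in> T then f p else 0)"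
  have "(\<Sum>p\<in>T. \<Sum>q\<in>T. g p * g q * kap p q) = (\<Sum>p\<in>T. \<Sum>q\<in>T. f p * f q * kap p q)"
    by (intro sum.cong refl) (auto simp: g_def)
  then have "bilin g g = 1/4 * ip g g"
    using zero form_support[OF assms(1), of g] by (simp add: g_def)
  then have "(\<Sum>y\<in>N x. (\<Sum>z\<in>N y. g z) / d y) = 1/4 * d x * g x"
    using minimiser_equation[OF form_nonneg] \<open>x \<in> V\<close> by blast
  moreover have "(\<Sum>y\<in>N x. (\<Sum>z\<in>N y. g z) / d y) = (\<Sum>p\<in>T. g p * common p x)"
    by (rule two_steps_common[OF assms(1)]) (simp add: g_def)
  ultimately have "(\<Sum>p\<in>T. g p * common p x) = 0"
    using \<open>x \<notin> T\<close> by (simp add: g_def)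
  then show ?thesis by (simp add: g_def cong: sum.cong)
qed

lemma two_point:
  assumes "p \<in> V" "q \<in> V" "p \<noteq> q"
  shows "a\<^sup>2 * G p + b\<^sup>2 * G q + 8 * a * b * common p q \<ge> 0"
  using kap_form_nonneg[of "{p, q}" "\<lambda>x. if x = p then a else b"] assms
  by (simp add: kap_diag kap_sym[of q p] power2_eq_square) (simp add: kap_def)

lemma G_nonneg: "p \<in> V \<Longrightarrow> G p \<ge> 0"
  using kap_form_nonneg[of "{p}" "\<lambda>_. 1"] by (simp add: kap_diag)

lemma pair_bound:
  assumes "w \<in> N p" "w \<in> N q" "p \<noteq> q"
  shows "G p + G q \<ge> 8 / d w"
  using two_point[of p q 1 "-1"] common_ge[OF assms(1,2)] assms nbr_in_V by auto

section \<open>Leaves and the vertices that carry them\<close>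

definition leaf :: "'a \<Rightarrow> bool" where "leaf v \<longleftrightarrow> deg V E v = 1"
definition bearing :: "'a \<Rightarrow> bool" where "bearing w \<longleftrightarrow> (\<exists>l\<in>N w. leaf l)"
definition J :: "'a \<Rightarrow> 'a set" where "J v = {w \<in> N v. bearing w}"

lemma nbrs_leaf: "leaf l \<Longrightarrow> w \<in> N l \<Longrightarrow> N l = {w}"
  by (auto simp: leaf_def deg_def card_1_singleton_iff)

lemma G_leaf: "leaf l \<Longrightarrow> w \<in> N l \<Longrightarrow> G l = 4 / d w - 1"
  using nbrs_leaf[of l w] by (simp add: G_def)

text \<open>Two adjacent leaves would be a whole component, but the connected graph has at least
  three vertices.\<close>

lemma leaf_nbr_deg_ge_2:
  assumes "leaf l" "w \<in> N l" shows "deg V E w \<ge> 2"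
proof (rule ccontr)
  assume "\<not> ?thesis"
  then have "leaf w"
    using deg_ge_1[of w] nbr_in_V(1)[OF assms(2)] by (simp add: leaf_def)
  then have "N w = {l}" "N l = {w}"
    using nbrs_leaf[OF _ nbrs_symD] nbrs_leaf assms by blast+
  then have "V \<subseteq> {w, l}"
    using closed_subset_eq_V[of w "{w, l}"] nbr_in_V(1)[OF assms(2)] by auto
  then have "card V \<le> card {w, l}" by (intro card_mono) auto
  also have "\<dots> \<le> 2" by (simp add: card_insert_if)
  finally show False using card_V by simp
qed

text \<open>Two leaves at \<open>w\<close> would have \<open>G\<close>-values summing to 8 / d w -
  2, below \<open>pair_bound\<close>.\<close>

lemma leaf_unique:
  assumes "leaf l" "leaf l'" "l \<in> N w" "l' \<in> N w"
  shows "l = l'"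
proof (rule ccontr)
  assume "l \<noteq> l'"
  have "w \<in> N l" "w \<in> N l'" using assms nbrs_symD by blast+
  then show False
    using pair_bound[of w l l'] G_leaf[of l w] G_leaf[of l' w] \<open>l \<noteq> l'\<close> assms by simp
qed

lemma bearing_d_le_4: assumes "bearing w" shows "d w \<le> 4"
proof -
  obtain l where l: "l \<in> N w" "leaf l" using assms by (auto simp: bearing_def)
  then have "4 / d w - 1 \<ge> 0"
    using G_nonneg[OF nbr_in_V(1)[OF l(1)]] G_leaf[OF l(2) nbrs_symD[OF l(1)]] by simp
  then show ?thesis using d_pos[of w] nbr_in_V(2)[OF l(1)] by (simp add: field_simps)
qed

lemma common_leaf:
  assumes "leaf l" "l \<in> N w" "p \<noteq> l"
  shows "common p l = (if w \<in> N p then 1 / d w else 0)"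
proof -
  have "N l = {w}" using nbrs_leaf assms nbrs_symD by blast
  then show ?thesis by (auto simp: common_def)
qed

text \<open>Weights -1 at \<open>v\<close> and t at the leaf give the bound t^2 - (4 t^2 - 8 t) / d
  w. The choice t = 4 is optimal for \<open>d w = 3\<close>, where it improves on the bound 4 that t
  = 2 gives.\<close>

lemma G_ge_bearing:
  assumes v: "deg V E v \<ge> 2" and w: "w \<in> J v"
  shows "G v \<ge> 16 - 32 / d w"
proof -
  obtain l where l: "l \<in> N w" "leaf l" using w by (auto simp: bearing_def J_def)
  have ne: "v \<noteq> l" using l v by (auto simp: leaf_def)
  have wv: "w \<in> N v" using w by (simp add: J_def)
  have "common v l = 1 / d w" using common_leaf[OF l(2,1) ne] wv by simp
  moreover have "G l = 4 / d w - 1" using G_leaf[OF l(2) nbrs_symD[OF l(1)]] .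
  moreover have "(-2)\<^sup>2 * G v + 8\<^sup>2 * G l + 8 * (-2) * 8 * common v l \<ge> 0"
    using ne wv l nbr_in_V by (intro two_point) auto
  ultimately show ?thesis by simp
qed

text \<open>Weight -2 at \<open>v\<close> and 4 at one leaf of each \<open>w\<close> in
  \<open>J v\<close>. This ratio makes all terms in 1 / d w cancel, and leaves at different vertices
  have no common neighbour, so the contributions simply add up.\<close>

lemma G_ge_J:
  assumes v: "deg V E v \<ge> 2"
  shows "G v \<ge> 4 * card (J v)"
proof -
  define lf where "lf w = (SOME l. l \<in> N w \<and> leaf l)" for w
  have lf: "lf w \<in> N w" "leaf (lf w)" if "w \<in> J v" for w
  proof -
    have "\<exists>l. l \<in> N w \<and> leaf l" using that by (auto simp: J_def bearing_def)
    then show "lf w \<in> N w" "leaf (lf w)" unfolding lf_def by (metis (mono_tags, lifting) someI_ex)+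
  qed
  have fin: "finite (J v)" using finite_nbrs by (simp add: J_def)
  have N_lf: "N (lf w) = {w}" if "w \<in> J v" for w
    by (rule nbrs_leaf[OF lf(2)[OF that] nbrs_symD[OF lf(1)[OF that]]])
  have inj: "inj_on lf (J v)"
    by (rule inj_onI) (metis N_lf singleton_inject)
  have ne: "v \<notin> lf ` J v" using lf(2) v by (auto simp: leaf_def)
  have J_N: "w \<in> N v" if "w \<in> J v" for w using that by (simp add: J_def)
  show ?thesis
  proof (cases "J v = {}")
    case True
    have "N v \<noteq> {}" using v by (auto simp: deg_def)
    then have "v \<in> V" using nbr_in_V(2) by blast
    then show ?thesis using True G_nonneg by simp
  next
    case False
    then have "v \<in> V" using J_N nbr_in_V by blast
    define f where "f = (\<lambda>x. if x = v then - 2 else 4 :: real)"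
    have vl: "kap v (lf w) = 1 / d w" if "w \<in> J v" for w
      using common_leaf[OF lf(2,1)[OF that], of v] ne that J_N[OF that] by (auto simp: kap_def)
    have ll: "kap (lf w) (lf w') = (if w = w' then 1 / d w - 1/4 else 0)"
      if "w \<in> J v" "w' \<in> J v" for w w'
    proof (cases "w = w'")
      case True
      then show ?thesis
        using G_leaf[OF lf(2)[OF that(1)] nbrs_symD[OF lf(1)[OF that(1)]]] by (simp add: kap_diag)
    next
      case F: False
      then have ne2: "lf w \<noteq> lf w'" using inj that by (auto dest: inj_onD)
      then show ?thesis
        using F ne2 N_lf[OF that(1)] common_leaf[OF lf(2,1)[OF that(2)] ne2] by (simp add: kap_def)
    qed
    have "0 \<le> (\<Sum>p\<in>insert v (lf ` J v). \<Sum>q\<in>insert v (lf ` J v). f p * f q * kap p q)"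
      using lf nbr_in_V \<open>v \<in> V\<close> by (intro kap_form_nonneg) auto
    also have "\<dots> = f v * f v * kap v v + (\<Sum>w\<in>J v. f v * f (lf w) * kap v (lf w))
        + (\<Sum>w\<in>J v. f (lf w) * f v * kap (lf w) v + (\<Sum>w'\<in>J v. f (lf w) * f (lf w') * kap (lf w) (lf w')))"
      using fin ne by (simp add: sum.reindex[OF inj])
    also have "\<dots> = 4 * kap v v + (\<Sum>w\<in>J v. - 8 / d w)
        + (\<Sum>w\<in>J v. - 8 / d w + (\<Sum>w'\<in>J v. if w = w' then 16 * (1 / d w - 1/4) else 0))"
    proof -
      have fl: "f (lf w) = 4" if "w \<in> J v" for w using ne that by (auto simp: f_def)
      have fv: "f v = - 2" by (simp add: f_def)
      have 1: "(\<Sum>w\<in>J v. f v * f (lf w) * kap v (lf w)) = (\<Sum>w\<in>J v. - 8 / d w)"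
        by (rule sum.cong) (simp_all add: fl fv vl)
      have 2: "(\<Sum>w'\<in>J v. f (lf w) * f (lf w') * kap (lf w) (lf w'))
          = (\<Sum>w'\<in>J v. if w = w' then 16 * (1 / d w - 1/4) else 0)" if "w \<in> J v" for w
        using that by (intro sum.cong refl) (simp add: fl ll)
      have 3: "f (lf w) * f v * kap (lf w) v = - 8 / d w" if "w \<in> J v" for w
        using that kap_sym[of "lf w" v] by (simp add: fl fv vl)
      have 4: "(\<Sum>w\<in>J v. f (lf w) * f v * kap (lf w) v + (\<Sum>w'\<in>J v. f (lf w) * f (lf w') * kap (lf w) (lf w')))
          = (\<Sum>w\<in>J v. - 8 / d w + (\<Sum>w'\<in>J v. if w = w' then 16 * (1 / d w - 1/4) else 0))"
        using 2 3 by (intro sum.cong refl) simp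
      show ?thesis
        unfolding 1 4 by (simp add: fv)
    qed
    \<comment> \<open>Each \<open>w\<close> yields -16 / d w from its two cross terms and 16 / d w -
      4 from the diagonal.\<close>
    also have "\<dots> = G v - 4 * card (J v)"
    proof -
      have "(\<Sum>w\<in>J v. - 8 / d w + (\<Sum>w'\<in>J v. if w = w' then 16 * (1 / d w - 1/4) else 0))
          = (\<Sum>w\<in>J v. 8 / d w - 4)"
        using fin by (intro sum.cong refl) (simp add: field_simps)
      then show ?thesis
        by (simp add: kap_diag sum_subtractf sum_negf)
    qed
    finally show ?thesis by simp
  qed
qed

lemma weight_le: "0 < k \<Longrightarrow> k \<le> deg V E x \<Longrightarrow> 4 / d x - 1 \<le> 4 / real k - 1"
  by (simp add: frac_le)

lemma nbrs_deg_2: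
  assumes "deg V E v = 2" "u \<in> N v"
  obtains u' where "N v = {u, u'}" "u \<noteq> u'"
proof -
  have "card (N v - {u}) = 1" using assms finite_nbrs by (simp add: deg_def)
  then obtain u' where u': "N v - {u} = {u'}" by (auto simp: card_1_singleton_iff)
  then have "N v = {u, u'}" "u \<noteq> u'" using assms(2) by auto
  then show thesis by (rule that)
qed

lemma nbrs_deg_3:
  assumes "deg V E v = 3" "u \<in> N v"
  obtains a b where "N v = {u, a, b}" "u \<noteq> a" "u \<noteq> b" "a \<noteq> b"
proof -
  have "card (N v - {u}) = 2" using assms finite_nbrs by (simp add: deg_def)
  then obtain a b where ab: "N v - {u} = {a, b}" "a \<noteq> b" by (auto simp: card_2_iff)
  then have "N v = {u, a, b}" "u \<noteq> a" "u \<noteq> b" using assms(2) by auto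
  then show thesis using ab(2) by (rule that)
qed

lemma not_bearing_deg_ge_2:
  assumes "\<not> bearing w" "x \<in> N w" shows "deg V E x \<ge> 2"
  using assms deg_ge_1[of x] nbr_in_V(1)[OF assms(2)] by (auto simp: bearing_def leaf_def)

lemma not_bearing_G_le:
  assumes "\<not> bearing w" shows "G w \<le> d w"
proof -
  have "G w \<le> (\<Sum>x\<in>N w. 1)"
    unfolding G_def using not_bearing_deg_ge_2[OF assms] weight_le[of 2]
    by (intro sum_mono) fastforce
  then show ?thesis by (simp add: deg_def)
qed

lemma not_bearing_G_eq:
  assumes "\<not> bearing w" "G w = d w" "x \<in> N w" shows "deg V E x = 2"
proof (rule ccontr)
  assume ne: "deg V E x \<noteq> 2"
  have "G w < (\<Sum>x\<in>N w. 1)"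
    unfolding G_def
  proof (rule sum_strict_mono_ex1)
    show "\<forall>x\<in>N w. 4 / d x - 1 \<le> 1"
      using not_bearing_deg_ge_2[OF assms(1)] weight_le[of 2] by fastforce
    show "\<exists>x\<in>N w. 4 / d x - 1 < 1"
      using ne not_bearing_deg_ge_2[OF assms(1,3)] weight_le[of 3 x] assms(3) by (intro bexI[of _ x]) auto
  qed (rule finite_nbrs)
  then show False using assms by (simp add: deg_def)
qed

text \<open>The pairing into petals is implicit: the second neighbour of a \<open>v\<close> in
  \<open>N w\<close> can only lie in \<open>N w\<close> again.\<close>

definition petal_like :: bool where
  "petal_like \<longleftrightarrow> (\<exists>w\<in>V. V = insert w (N w) \<and> (\<forall>v\<in>N w. deg V E v = 2))"

definition book_like :: bool where
  "book_like \<longleftrightarrow> (\<exists>w\<in>V. \<exists>z\<in>V. w \<noteq> z \<and> z \<notin> N w \<and> N w \<inter> N z = {} \<and> V = {w, z} \<union> N w \<union> N z \<and>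
     (\<forall>v\<in>N w. \<exists>x\<in>N z. N v = {w, x}) \<and> (\<forall>x\<in>N z. \<exists>v\<in>N w. N x = {z, v}))"

section \<open>Rigidity around two adjacent vertices of degree 2\<close>

lemma G_deg_2: "N u = {a, b} \<Longrightarrow> a \<noteq> b \<Longrightarrow> G u = 4 / d a + 4 / d b - 2"
  by (simp add: G_def)

text \<open>The weight 1 of \<open>u'\<close> gives G u = 4 / d w, while a leaf at \<open>w\<close>
  forces G u \<ge> 4. Then \<open>w\<close> is itself a leaf, and its only neighbour
  \<open>u\<close> has degree 2.\<close>

lemma adjacent_deg_2_not_bearing:
  assumes u: "N u = {u', w}" "u' \<noteq> w" and "deg V E u' = 2"
  shows "\<not> bearing w"
proof
  assume b: "bearing w"
  have w: "w \<in> N u" using u by simp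
  have du: "deg V E u = 2" using u by (simp add: deg_def)
  have "w \<in> J u" using b w by (simp add: J_def)
  then have "card (J u) \<ge> 1"
    using finite_nbrs card_gt_0_iff[of "J u"] by (auto simp: J_def Suc_le_eq)
  then have "G u \<ge> 4" using G_ge_J[of u] du by simp
  then have "4 / d w \<ge> 4"
    using G_deg_2[OF u] assms(3) by simp
  then have "d w \<le> 1" using d_pos[of w] nbr_in_V(1)[OF w] by (simp add: field_simps)
  then have "leaf w" using deg_ge_1[of w] nbr_in_V(1)[OF w] by (simp add: leaf_def)
  then have "N w = {u}" using nbrs_leaf w nbrs_symD by blast
  then show False using b du by (simp add: bearing_def leaf_def)
qed

lemma card_deg_2_nbrs:
  assumes "\<And>x. x \<in> N w \<Longrightarrow> deg V E x = 2"
  shows "common w x = card (N w \<inter> N x) / 2"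
proof -
  have "common w x = (\<Sum>y\<in>N w \<inter> N x. 1/2)"
    unfolding common_def using assms by (intro sum.cong refl) auto
  then show ?thesis by simp
qed

text \<open>The test function is \<open>-2\<close> at \<open>w\<close> and \<open>deg z\<close> at \<open>u'\<close>.\<close>

lemma adjacent_deg_2_G_ge:
  assumes u: "N u = {u', w}" "u' \<noteq> w" and u': "N u' = {u, z}" "u \<noteq> z" and "w \<noteq> z"
  shows "G w \<ge> d z" and "z \<in> N w \<Longrightarrow> G w \<ge> d z + 4"
proof -
  have V: "w \<in> V" "u' \<in> V" "z \<in> V" "u \<in> V"
    using u u' nbr_in_V by blast+
  have uw: "u \<in> N w" using u nbrs_symD by blast
  have du: "d u = 2" using u by (simp add: deg_def)
  have G': "G u' = 4 / d z" using G_deg_2[OF u'] du by simp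
  have two: "4 * G w + (d z)\<^sup>2 * G u' - 16 * d z * common w u' \<ge> 0"
    using two_point[of w u' "-2" "d z"] V u by simp
  have sq: "(d z)\<^sup>2 * G u' = 4 * d z"
    using d_pos[OF V(3)] by (simp add: G' power2_eq_square)
  have "common w u' \<ge> 1/2"
    using common_ge[of u w u'] uw u' du by simp
  then have "16 * d z * common w u' \<ge> 8 * d z"
    using d_pos[OF V(3)] mult_left_mono[of "1/2" "common w u'" "16 * d z"] by simp
  then show "G w \<ge> d z" using two sq by linarith
  assume zw: "z \<in> N w"
  \<comment> \<open>A second common neighbour: its 1 / d z raises the bound by 4, the surplus that
    excludes an edge between \<open>w\<close> and \<open>z\<close> in the book case.\<close>
  have "N w \<inter> N u' = {u, z}" using uw zw u' by auto
  then have "common w u' = 1/2 + 1 / d z" using u'(2) du by (simp add: common_def)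
  then have "16 * d z * common w u' = 8 * d z + 16"
    using d_pos[OF V(3)] by (simp add: field_simps)
  then show "G w \<ge> d z + 4" using two sq by linarith
qed

text \<open>On the path w, u, u', z the bounds close up to d z \<le> G w \<le> d w \<le> G z \<le> d
  z. So all neighbours of \<open>w\<close> and \<open>z\<close> have degree 2, the test function is
  null, and its kernel equations determine the rest.\<close>

lemma adjacent_deg_2_book:
  assumes u: "N u = {u', w}" "u' \<noteq> w" and u': "N u' = {u, z}" "u \<noteq> z" and wz: "w \<noteq> z"
  shows book_like
proof -
  have V: "w \<in> V" "u' \<in> V" "z \<in> V" "u \<in> V"
    using u u' nbr_in_V by blast+
  have du: "deg V E u = 2" "deg V E u' = 2" using u u' by (simp_all add: deg_def)
  have nb: "\<not> bearing w" "\<not> bearing z"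
    using adjacent_deg_2_not_bearing[OF u] adjacent_deg_2_not_bearing[OF u'] du by auto
  note ge_w = adjacent_deg_2_G_ge[OF u u' wz]
    and ge_z = adjacent_deg_2_G_ge[OF u' u wz[symmetric]]
  have eq: "d w = d z" "G w = d w" "G z = d z"
    using ge_w(1) ge_z(1) not_bearing_G_le[OF nb(1)] not_bearing_G_le[OF nb(2)] by auto
  have zw: "z \<notin> N w" using ge_w(2) eq by auto
  have deg2: "x \<in> N w \<Longrightarrow> deg V E x = 2" "x \<in> N z \<Longrightarrow> deg V E x = 2" for x
    using not_bearing_G_eq[OF nb(1) eq(2)] not_bearing_G_eq[OF nb(2) eq(3)] by blast+
  have uw: "u \<in> N w" "u' \<in> N z" using u u' nbrs_symD by blast+
  have Nwu': "N w \<inter> N u' = {u}" using uw zw u' by auto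
  have cwu': "common w u' = 1/2" using Nwu' du by (simp add: common_def)
  define f where "f = (\<lambda>p. if p = w then - 2 else d z)"
  have G': "G u' = 4 / d z" using G_deg_2[OF u'] du by simp
  have zero: "(\<Sum>p\<in>{w, u'}. \<Sum>q\<in>{w, u'}. f p * f q * kap p q) = 0"
  proof -
    have "(\<Sum>p\<in>{w, u'}. \<Sum>q\<in>{w, u'}. f p * f q * kap p q)
        = 4 * kap w w - 4 * d z * kap w u' + d z * d z * kap u' u'"
      using u(2) by (simp add: f_def kap_sym[of u' w])
    also have "\<dots> = 0"
      using cwu' u(2) eq G' d_pos[OF V(3)] by (simp add: kap_diag) (simp add: kap_def)
    finally show ?thesis .
  qed
  \<comment> \<open>The kernel equation at \<open>x\<close> compares \<open>common w x\<close>, half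
    the number of common neighbours, with \<open>common u' x\<close>. As \<open>u\<close> is
    adjacent only to \<open>u'\<close> and \<open>w\<close>, the latter can only come from
    \<open>z\<close>. The vertex \<open>u'\<close> lies in the support and is treated
    directly.\<close>
  have count: "card (N w \<inter> N x) = (if x \<in> N z then 1 else 0)" if "x \<in> V" "x \<noteq> w" for x
  proof (cases "x = u'")
    case True
    then show ?thesis using Nwu' uw by simp
  next
    case False
    have "(\<Sum>p\<in>{w, u'}. f p * common p x) = 0"
      using False that V by (intro kap_form_kernel[OF _ zero]) auto
    then have "2 * common w x = d z * common u' x"
      using u(2) by (simp add: f_def)
    moreover have "N u' \<inter> N x = (if x \<in> N z then {z} else {})"
      using u u' False that nbrs_sym[of u x] nbrs_sym[of z x] by auto
    then have "d z * common u' x = (if x \<in> N z then 1 else 0)"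
      using d_pos[OF V(3)] by (simp add: common_def)
    ultimately show ?thesis
      using card_deg_2_nbrs[of w x, OF deg2(1)] by (auto split: if_splits)
  qed
  have disj: "N w \<inter> N z = {}"
    using count[OF V(3)] wz not_self_nbr finite_nbrs by (auto split: if_splits)
  have page_w: "\<exists>x\<in>N z. N v = {w, x}" if v: "v \<in> N w" for v
  proof -
    obtain x where x: "N v = {w, x}" "w \<noteq> x"
      using nbrs_deg_2[OF deg2(1)[OF v], of w] v nbrs_symD by blast
    then have "v \<in> N w \<inter> N x" "x \<in> V" using v nbrs_symD nbr_in_V by blast+
    then have "card (N w \<inter> N x) \<noteq> 0" using finite_nbrs by auto
    then have "x \<in> N z" using count[OF \<open>x \<in> V\<close>] x by (auto split: if_splits)
    then show ?thesis using x by blast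
  qed
  have page_z: "\<exists>v\<in>N w. N x = {z, v}" if x: "x \<in> N z" for x
  proof -
    have "x \<in> V" "x \<noteq> w" using x zw nbrs_symD nbr_in_V by blast+
    then have "card (N w \<inter> N x) = 1" using count x by simp
    then obtain v where v: "v \<in> N w" "v \<in> N x" by (auto simp: card_1_singleton_iff)
    then have "v \<noteq> z" using zw by blast
    have "z \<in> N x" using x nbrs_symD by blast
    then show ?thesis
      using nbrs_deg_2[OF deg2(2)[OF x], of z] v \<open>v \<noteq> z\<close> by (metis insertE singletonD)
  qed
  have "V \<subseteq> {w, z} \<union> N w \<union> N z"
  proof (rule closed_subset_eq_V[OF _ V(1)])
    fix a b assume a: "a \<in> {w, z} \<union> N w \<union> N z" and b: "b \<in> N a"
    then consider "a = w" | "a = z" | "a \<in> N w" | "a \<in> N z" by blast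
    then show "b \<in> {w, z} \<union> N w \<union> N z"
      by cases (use b page_w page_z in blast)+
  qed simp
  then have "V = {w, z} \<union> N w \<union> N z"
    using V nbrs_subset by blast
  then show ?thesis
    unfolding book_like_def using V wz zw disj page_w page_z by blast
qed

text \<open>The test function is \<open>-2\<close> at \<open>w\<close> and \<open>deg w / 2\<close> at \<open>u\<close> and \<open>u'\<close>.\<close>

lemma adjacent_deg_2_petal:
  assumes u: "N u = {u', w}" "u' \<noteq> w" and u': "N u' = {u, w}" "u \<noteq> w"
  shows petal_like
proof -
  have V: "w \<in> V" "u' \<in> V" "u \<in> V"
    using u u' nbr_in_V by blast+
  have uu': "u \<noteq> u'" using u not_self_nbr by blast
  have du: "deg V E u = 2" "deg V E u' = 2" using u u' by (simp_all add: deg_def)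
  have nb: "\<not> bearing w"
    using adjacent_deg_2_not_bearing[OF u] du by auto
  have uw: "u \<in> N w" "u' \<in> N w" using u u' nbrs_symD by blast+
  have G: "G u = 4 / d w" "G u' = 4 / d w" using G_deg_2[OF u] G_deg_2[OF u'] du by auto
  have I: "N w \<inter> N u = {u'}" "N w \<inter> N u' = {u}" "N u \<inter> N u' = {w}"
    using u u' uw not_self_nbr uu' by auto
  have c: "common w u = 1/2" "common w u' = 1/2" "common u u' = 1 / d w"
    using I du by (simp_all add: common_def)
  define f where "f = (\<lambda>p. if p = w then - 2 else d w / 2)"
  have val: "(\<Sum>p\<in>{w, u, u'}. \<Sum>q\<in>{w, u, u'}. f p * f q * kap p q) = G w - d w"
  proof -
    have "(\<Sum>p\<in>{w, u, u'}. \<Sum>q\<in>{w, u, u'}. f p * f q * kap p q)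
        = 4 * kap w w - 2 * d w * kap w u - 2 * d w * kap w u' + d w * d w / 2 * kap u u'
          + d w * d w / 4 * (kap u u + kap u' u')"
      using u(2) u'(2) uu' by (simp add: f_def kap_sym[of u' u] kap_sym[of u w] kap_sym[of u' w] algebra_simps)
    also have "\<dots> = G w - d w"
    proof -
      have k: "kap w u = 1/2" "kap w u' = 1/2" "kap u u' = 1 / d w"
        using c u(2) u'(2) uu' by (simp_all add: kap_def)
      show ?thesis unfolding k kap_diag G using d_pos[OF V(1)] by simp
    qed
    finally show ?thesis .
  qed
  \<comment> \<open>The opposite bound holds because \<open>w\<close> carries no leaf, so the test
    function is null.\<close>
  have "G w \<ge> d w"
    using kap_form_nonneg[of "{w, u, u'}" f] val V by simp
  then have eq: "G w = d w" using not_bearing_G_le[OF nb] by simp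
  have deg2: "x \<in> N w \<Longrightarrow> deg V E x = 2" for x
    using not_bearing_G_eq[OF nb eq] .
  \<comment> \<open>A vertex \<open>b\<close> at distance two from \<open>w\<close> shares no
    neighbour with \<open>u\<close> or \<open>u'\<close>, so the kernel equation at \<open>b\<close>
    would make \<open>common w b\<close> vanish although \<open>v\<close> is a common
    neighbour.\<close>
  have step: "b \<in> insert w (N w)" if v: "v \<in> N w" and b: "b \<in> N v" for v b
  proof (cases "b \<in> {w, u, u'}")
    case True
    then show ?thesis using uw by auto
  next
    case False
    have "b \<in> V" using b nbr_in_V by blast
    then have "(\<Sum>p\<in>{w, u, u'}. f p * common p b) = 0"
      using False V eq val by (intro kap_form_kernel) auto
    then have *: "4 * common w b = d w * common u b + d w * common u' b"
      using u(2) u'(2) uu' by (simp add: f_def algebra_simps)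
    have "v \<in> N w \<inter> N b" using v b nbrs_symD by blast
    then have "card (N w \<inter> N b) > 0" using finite_nbrs card_gt_0_iff by blast
    then have "common w b > 0" using card_deg_2_nbrs[of w b, OF deg2] by simp
    show ?thesis
    proof (rule ccontr)
      assume "b \<notin> insert w (N w)"
      then have "N u \<inter> N b = {}" "N u' \<inter> N b = {}"
        using False u u' nbrs_sym[of u b] nbrs_sym[of u' b] nbrs_sym[of w b] by auto
      then show False using * \<open>common w b > 0\<close> by (simp add: common_def)
    qed
  qed
  have "V \<subseteq> insert w (N w)"
    by (rule closed_subset_eq_V[OF _ V(1)]) (use step in auto)
  then have "V = insert w (N w)" using V nbrs_subset by blast
  then show ?thesis unfolding petal_like_def using V deg2 by blast
qed

lemma adjacent_deg_2:
  assumes "deg V E u = 2" "deg V E u' = 2" "u' \<in> N u"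
  shows "petal_like \<or> book_like"
proof -
  obtain w where w: "N u = {u', w}" "u' \<noteq> w"
    using nbrs_deg_2 assms by blast
  obtain z where z: "N u' = {u, z}" "u \<noteq> z"
    using nbrs_deg_2 assms nbrs_symD by blast
  show ?thesis
    using adjacent_deg_2_book[OF w z] adjacent_deg_2_petal[OF w, folded] z by (cases "w = z") auto
qed

end

section \<open>Existence of adjacent vertices of degree 2\<close>

locale no_adjacent_deg_2 = gapped_graph +
  assumes no_adjacent: "u' \<in> N u \<Longrightarrow> deg V E u = 2 \<Longrightarrow> deg V E u' \<noteq> 2"
begin

lemma G_le: "(\<And>x. x \<in> N v \<Longrightarrow> 4 / d x - 1 \<le> c x) \<Longrightarrow> G v \<le> (\<Sum>x\<in>N v. c x)"
  unfolding G_def by (rule sum_mono)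

lemma weight_le_num:
  "2 \<le> deg V E x \<Longrightarrow> 4 / d x \<le> 2"
  "3 \<le> deg V E x \<Longrightarrow> 4 / d x \<le> 4/3"
  "4 \<le> deg V E x \<Longrightarrow> 4 / d x \<le> 1"
  using weight_le[of 2 x] weight_le[of 3 x] weight_le[of 4 x] by simp_all

lemma J_nonempty_G_ge_4:
  assumes "w \<in> N v" "bearing w" "deg V E v \<ge> 2" shows "G v \<ge> 4"
proof -
  have "card (J v) \<ge> 1"
    using assms finite_nbrs card_gt_0_iff[of "J v"] by (auto simp: J_def Suc_le_eq)
  then show ?thesis using G_ge_J[OF assms(3)] by simp
qed

lemma bearing_deg_ge_2: assumes "bearing v" shows "deg V E v \<ge> 2"
proof -
  obtain l where "l \<in> N v" "leaf l" using assms by (auto simp: bearing_def)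
  then show ?thesis using leaf_nbr_deg_ge_2 nbrs_symD by blast
qed

text \<open>\<open>G v\<close> gets 3 from the leaf, 4 / d w - 1 from \<open>w\<close> and at most 1
  from each of the other d v - 2 neighbours; this is compared with
  \<open>G_ge_bearing\<close>.\<close>

lemma adjacent_bearing_bound:
  assumes "w \<in> N v" "bearing v" "bearing w" shows "36 / d w \<ge> 16 - d v"
proof -
  obtain l where l: "l \<in> N v" "leaf l" using assms by (auto simp: bearing_def)
  have ge2: "deg V E v \<ge> 2" "deg V E w \<ge> 2"
    using assms bearing_deg_ge_2 by blast+
  then have "w \<noteq> l" using l by (auto simp: leaf_def)
  have "G v \<le> (\<Sum>x\<in>N v. 1 + (if x = w then 4 / d w - 2 else 0) + (if x = l then 2 else 0))"
  proof (rule G_le)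
    fix x assume x: "x \<in> N v"
    consider "x = w" | "x = l" | "x \<noteq> w" "x \<noteq> l" "deg V E x \<ge> 2"
      using leaf_unique[OF l(2) _ l(1) x] deg_ge_1[OF nbr_in_V(1)[OF x]] by (fastforce simp: leaf_def)
    then show "4 / d x - 1 \<le> 1 + (if x = w then 4 / d w - 2 else 0) + (if x = l then 2 else 0)"
      using \<open>w \<noteq> l\<close> l(2) weight_le_num(1)[of x] by cases (auto simp: leaf_def)
  qed
  also have "\<dots> = d v + 4 / d w"
    using assms(1) l(1) finite_nbrs by (simp add: sum.distrib deg_def)
  finally show ?thesis
    using G_ge_bearing[of v w] assms ge2 by (simp add: J_def)
qed

text \<open>Both degrees lie between 2 and 4, and the two symmetric inequalities leave only the pair
  (2, 2), which is excluded here.\<close>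

lemma adjacent_not_bearing:
  assumes "w \<in> N v" "bearing v" shows "\<not> bearing w"
proof
  assume w: "bearing w"
  have le4: "deg V E v \<le> 4" "deg V E w \<le> 4"
    using bearing_d_le_4 assms w by fastforce+
  have ge2: "deg V E v \<ge> 2" "deg V E w \<ge> 2"
    using assms w bearing_deg_ge_2 by blast+
  have b: "36 / d w \<ge> 16 - d v" "36 / d v \<ge> 16 - d w"
    using adjacent_bearing_bound assms w nbrs_symD by blast+
  have "deg V E v \<in> {2, 3, 4}" "deg V E w \<in> {2, 3, 4}" using le4 ge2 by auto
  then have "deg V E v = 2 \<and> deg V E w = 2"
    using b by auto
  then show False using no_adjacent assms(1) by blast
qed

lemma deg_2_nbr_ge_3:
  assumes "deg V E p = 2" "\<not> bearing p" "x \<in> N p" shows "deg V E x \<ge> 3"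
  using not_bearing_deg_ge_2[OF assms(2,3)] no_adjacent[OF assms(3,1)] by simp

text \<open>Without leaves the second neighbours have degree at least 3, whence G x + G y \<le> 8 /
  d z - 4/3, against \<open>pair_bound\<close>.\<close>

lemma two_deg_2_nbrs:
  assumes "x \<in> N z" "y \<in> N z" "x \<noteq> y" "deg V E x = 2" "deg V E y = 2"
  shows "bearing x \<or> bearing y"
proof (rule ccontr)
  assume nb: "\<not> ?thesis"
  obtain x' where x': "N x = {z, x'}" "z \<noteq> x'"
    using nbrs_deg_2[OF assms(4) nbrs_symD[OF assms(1)]] by blast
  obtain y' where y': "N y = {z, y'}" "z \<noteq> y'"
    using nbrs_deg_2[OF assms(5) nbrs_symD[OF assms(2)]] by blast
  have "deg V E x' \<ge> 3" "deg V E y' \<ge> 3"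
    using deg_2_nbr_ge_3[of x x'] deg_2_nbr_ge_3[of y y'] nb assms x' y' by auto
  then have "4 / d x' \<le> 4/3" "4 / d y' \<le> 4/3"
    using weight_le_num by blast+
  moreover have "G x + G y \<ge> 8 / d z"
    using pair_bound assms nbrs_symD by blast
  ultimately show False
    using G_deg_2[OF x'] G_deg_2[OF y'] by simp
qed

lemma G_deg_3: "N y = {z, a, b} \<Longrightarrow> z \<noteq> a \<Longrightarrow> z \<noteq> b \<Longrightarrow> a \<noteq> b \<Longrightarrow> G y = 4 / d z + 4 / d a + 4 / d b - 3"
  by (simp add: G_def)

text \<open>The aim is that \<open>p\<close> is the only neighbour of \<open>z\<close> with positive
  weight. Applied to both neighbours of \<open>p\<close>, the bound contradicts
  \<open>pair_bound\<close> through \<open>p\<close>.\<close>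

lemma deg_2_not_bearing_nbr:
  assumes p: "N p = {z, q}" "z \<noteq> q" and nb: "\<not> bearing p"
  shows "G z \<le> 1"
proof -
  have dp: "deg V E p = 2" using p by (simp add: deg_def)
  have ge3: "deg V E z \<ge> 3" "deg V E q \<ge> 3"
    using deg_2_nbr_ge_3[OF dp nb] p by auto
  have z4: "4 / d z \<le> 4/3" and q4: "4 / d q \<le> 4/3"
    using ge3 weight_le_num by blast+
  note Gp = G_deg_2[OF p]
  have pz: "p \<in> N z" "z \<in> N p" using p nbrs_symD by blast+
  have nz: "\<not> bearing z"
    using J_nonempty_G_ge_4[of z p] pz dp Gp z4 q4 by auto
  \<comment> \<open>This caps the degree of \<open>z\<close> at 6, so that \<open>G_ge_J\<close>
    allows at most one element of \<open>J z\<close>.\<close>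
  have "G p \<ge> 0" using G_nonneg pz nbr_in_V by blast
  then have "4 / d z \<ge> 2/3" using Gp q4 by simp
  then have z6: "d z \<le> 6"
    using ge3 by (simp add: field_simps)
  have J: "J z = {}"
  proof (rule ccontr)
    assume "J z \<noteq> {}"
    then obtain w where w: "w \<in> J z" by blast
    have fin: "finite (J z)" using finite_nbrs by (simp add: J_def)
    have "4 * real (card (J z)) \<le> 6"
      using G_ge_J[of z] ge3 not_bearing_G_le[OF nz] z6 by simp
    then have "card (J z) \<le> 1" by simp
    then have Jw: "J z = {w}"
      using w fin by (metis card_le_Suc0_iff_eq One_nat_def singletonI is_singletonI' is_singleton_the_elem singletonD empty_iff)
    \<comment> \<open>Only \<open>p\<close> and \<open>w\<close> can have degree 2; every other
      neighbour weighs at most 1/3, and 6/3 + 4/3 falls short of 4.\<close>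
    have "G z \<le> (\<Sum>x\<in>N z. 1/3 + (if x = p then 2/3 else 0) + (if x = w then 2/3 else 0))"
    proof (rule G_le)
      fix x assume x: "x \<in> N z"
      have x2: "4 / d x \<le> 2"
        using weight_le_num(1) not_bearing_deg_ge_2[OF nz x] by blast
      show "4 / d x - 1 \<le> 1/3 + (if x = p then 2/3 else 0) + (if x = w then 2/3 else 0)"
      proof (cases "x = p \<or> x = w")
        case True
        then show ?thesis using x2 by auto
      next
        case False
        then have "\<not> bearing x" using x Jw by (auto simp: J_def)
        then have "deg V E x \<noteq> 2"
          using two_deg_2_nbrs[OF pz(1) x] False dp nb by auto
        then have "deg V E x \<ge> 3" using not_bearing_deg_ge_2[OF nz x] by simp
        then show ?thesis using weight_le_num(2)[of x] False by simp
      qed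
    qed
    also have "\<dots> = d z / 3 + 4/3"
      using pz w finite_nbrs by (simp add: sum.distrib deg_def J_def)
    finally have "G z < 4" using z6 by simp
    then show False using J_nonempty_G_ge_4[of w z] w ge3 by (auto simp: J_def)
  qed
  have ge4: "deg V E y \<ge> 4" if y: "y \<in> N z" "y \<noteq> p" for y
  proof -
    have ny: "\<not> bearing y" using J y by (auto simp: J_def)
    have "deg V E y \<noteq> 2"
      using two_deg_2_nbrs[OF pz(1) y(1)] y(2) dp nb ny by auto
    moreover have "deg V E y \<noteq> 3"
    proof
      assume y3: "deg V E y = 3"
      obtain a b where ab: "N y = {z, a, b}" "z \<noteq> a" "z \<noteq> b" "a \<noteq> b"
        using nbrs_deg_3[OF y3 nbrs_symD[OF y(1)]] by blast
      note Gy = G_deg_3[OF ab]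
      have ab2: "deg V E a \<ge> 2" "deg V E b \<ge> 2"
        using not_bearing_deg_ge_2[OF ny] ab by auto
      then have ab2': "4 / d a \<le> 2" "4 / d b \<le> 2" using weight_le_num by blast+
      have "G p + G y \<ge> 8 / d z"
        using pair_bound[of z p y] pz y nbrs_symD by blast
      \<comment> \<open>Since 11/3 exceeds 2 + 4/3, neither \<open>a\<close> nor \<open>b\<close>
        can have degree 3 or more.\<close>
      then have s: "4 / d a + 4 / d b \<ge> 11/3" using Gp Gy q4 by simp
      then have "\<not> deg V E a \<ge> 3" "\<not> deg V E b \<ge> 3"
        using weight_le_num(2)[of a] weight_le_num(2)[of b] ab2' by linarith+
      then have "deg V E a = 2" "deg V E b = 2" using ab2 by auto
      moreover have "a \<in> N y" "b \<in> N y" using ab by auto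
      ultimately have "\<exists>c\<in>N y. bearing c"
        using two_deg_2_nbrs[of a y b] ab(4) by blast
      then have "G y \<ge> 4" using J_nonempty_G_ge_4 y3 by force
      then show False using Gy ab2' z4 by simp
    qed
    ultimately show ?thesis using not_bearing_deg_ge_2[OF nz y(1)] by simp
  qed
  have "G z \<le> (\<Sum>x\<in>N z. if x = p then 1 else 0)"
  proof (rule G_le)
    fix x assume x: "x \<in> N z"
    show "4 / d x - 1 \<le> (if x = p then 1 else 0)"
      using weight_le_num(3)[OF ge4[OF x]] dp by auto
  qed
  also have "\<dots> = 1" using pz finite_nbrs by simp
  finally show ?thesis .
qed

lemma deg_2_bearing:
  assumes dp: "deg V E p = 2" shows "bearing p"
proof (rule ccontr)
  assume nb: "\<not> bearing p"
  obtain z q where p: "N p = {z, q}" "z \<noteq> q"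
    using dp by (auto simp: deg_def card_2_iff)
  then have p': "N p = {q, z}" "q \<noteq> z" by auto
  have "G z \<le> 1" "G q \<le> 1"
    using deg_2_not_bearing_nbr[OF p nb] deg_2_not_bearing_nbr[OF p' nb] by auto
  moreover have "p \<in> N z" "p \<in> N q" using p nbrs_symD by blast+
  then have "G z + G q \<ge> 8 / d p" using pair_bound p(2) by blast
  ultimately show False using dp by simp
qed

text \<open>All weights are at most 1, so G z \<le> 3 < 4 and no neighbour carries a leaf. Hence
  none has degree 2, and the two other than \<open>v\<close> weigh at most 1/3 each.\<close>

lemma deg_3_not_bearing:
  assumes "v \<in> N z" "deg V E z = 3" "\<not> bearing z"
  shows "G z \<le> 4 / d v - 1/3"
proof -
  obtain a b where ab: "N z = {v, a, b}" "v \<noteq> a" "v \<noteq> b" "a \<noteq> b"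
    using nbrs_deg_3[OF assms(2,1)] by blast
  have two: "deg V E x \<ge> 2" if "x \<in> N z" for x
    using not_bearing_deg_ge_2[OF assms(3)] that .
  then have "4 / d v \<le> 2" "4 / d a \<le> 2" "4 / d b \<le> 2"
    using ab weight_le_num(1) by auto
  then have "G z < 4" using G_deg_3[OF ab] by simp
  then have "\<not> bearing x" if "x \<in> N z" for x
    using J_nonempty_G_ge_4[OF that] assms(2) by auto
  then have "deg V E x \<ge> 3" if "x \<in> N z" for x
    using two[OF that] deg_2_bearing[of x] that by fastforce
  then have "4 / d a \<le> 4/3" "4 / d b \<le> 4/3"
    using ab weight_le_num(2) by auto
  then show ?thesis using G_deg_3[OF ab] by simp
qed

text \<open>Two such neighbours would reach only 8 / d v - 2/3 where \<open>pair_bound\<close>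
  demands 8 / d v.\<close>

lemma deg_3_nbr_unique:
  assumes "x \<in> N v" "deg V E x = 3" "\<not> bearing x" and "y \<in> N v" "deg V E y = 3" "\<not> bearing y"
  shows "x = y"
proof (rule ccontr)
  assume "x \<noteq> y"
  have v: "v \<in> N x" "v \<in> N y" using assms nbrs_symD by blast+
  then show False
    using pair_bound[OF v \<open>x \<noteq> y\<close>] deg_3_not_bearing[OF v(1) assms(2,3)]
      deg_3_not_bearing[OF v(2) assms(5,6)] by simp
qed

text \<open>\<open>G_ge_J\<close> demands 4 for each element of \<open>J v\<close>, which
  contributes at most 1 itself. The only other positive contribution is 1/3, from at most one
  leafless neighbour of degree 3.\<close>

lemma nbrs_not_bearing:
  assumes v: "deg V E v \<ge> 2" and w: "w \<in> N v" shows "\<not> bearing w"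
proof
  assume b: "bearing w"
  have nv: "\<not> bearing v" using adjacent_not_bearing[OF nbrs_symD[OF w] b] .
  define T where "T = {x \<in> N v. \<not> bearing x \<and> deg V E x = 3}"
  have fin: "finite (J v)" "finite T" using finite_nbrs by (simp_all add: J_def T_def)
  have "G v \<le> (\<Sum>x\<in>N v. (if x \<in> J v then 1 else 0) + (if x \<in> T then 1/3 else 0))"
  proof (rule G_le)
    fix x assume x: "x \<in> N v"
    have x2: "deg V E x \<ge> 2" using not_bearing_deg_ge_2[OF nv x] .
    show "4 / d x - 1 \<le> (if x \<in> J v then 1 else 0) + (if x \<in> T then 1/3 else 0)"
    proof (cases "bearing x")
      case True
      then show ?thesis using weight_le_num(1)[OF x2] x by (simp add: J_def T_def)
    next
      case False
      then have "deg V E x = 3 \<or> deg V E x \<ge> 4"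
        using x2 deg_2_bearing[of x] by fastforce
      then show ?thesis
        using False x weight_le_num(3)[of x] by (auto simp: J_def T_def)
    qed
  qed
  also have "\<dots> = card (J v) + card T / 3"
  proof -
    have "N v \<inter> J v = J v" "N v \<inter> T = T" by (auto simp: J_def T_def)
    then show ?thesis
      using finite_nbrs by (simp add: sum.distrib sum.If_cases)
  qed
  finally have "card (J v) + card T / 3 \<ge> 4 * real (card (J v))"
    using G_ge_J[OF v] by linarith
  moreover have "w \<in> J v" using w b by (simp add: J_def)
  then have "card (J v) \<ge> 1" using fin card_gt_0_iff[of "J v"] by (auto simp: Suc_le_eq)
  ultimately have "card T > 1" by simp
  moreover have "x = y" if "x \<in> T" "y \<in> T" for x y
    using that deg_3_nbr_unique[of x v y] by (simp add: T_def)
  then have "card T \<le> 1" using card_le_Suc0_iff_eq[OF fin(2)] by simp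
  ultimately show False by simp
qed

section \<open>Minimum degree three and the final contradiction\<close>

lemma no_bearing: "\<not> bearing w"
proof
  assume b: "bearing w"
  then obtain l where l: "l \<in> N w" "leaf l" by (auto simp: bearing_def)
  have "\<not> N w \<subseteq> {l}"
    using bearing_deg_ge_2[OF b] card_mono[of "{l}" "N w"] by (auto simp: deg_def)
  then obtain v where v: "v \<in> N w" "v \<noteq> l" by blast
  then have "\<not> leaf v" using leaf_unique l by blast
  then have "deg V E v \<ge> 2" using deg_ge_1[OF nbr_in_V(1)[OF v(1)]] by (simp add: leaf_def)
  then show False using nbrs_not_bearing[OF _ nbrs_symD[OF v(1)]] b by blast
qed

lemma deg_ge_3: assumes "v \<in> V" shows "deg V E v \<ge> 3"
proof -
  have "deg V E v \<noteq> 2" using deg_2_bearing no_bearing by blast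
  moreover have "N v \<noteq> {}" using deg_ge_1[OF assms] by (auto simp: deg_def)
  then obtain w where "v \<in> N w" using nbrs_symD by blast
  then have "deg V E v \<ge> 2" using not_bearing_deg_ge_2 no_bearing by blast
  ultimately show ?thesis by simp
qed

lemma G_le_third: "G v \<le> 1/3"
proof -
  have "G v \<le> (\<Sum>x\<in>N v. if deg V E x = 3 then 1/3 else 0)"
  proof (rule G_le)
    fix x assume "x \<in> N v"
    then have "deg V E x = 3 \<or> deg V E x \<ge> 4" using deg_ge_3 nbr_in_V(1) by fastforce
    then show "4 / d x - 1 \<le> (if deg V E x = 3 then 1/3 else 0)"
      using weight_le_num(3)[of x] by auto
  qed
  also have "\<dots> = card {x \<in> N v. deg V E x = 3} / 3"
    using finite_nbrs by (simp add: sum.If_cases Int_def)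
  also have "\<dots> \<le> 1/3"
  proof -
    have fin: "finite {x \<in> N v. deg V E x = 3}" using finite_nbrs by simp
    have "\<forall>x\<in>{x \<in> N v. deg V E x = 3}. \<forall>y\<in>{x \<in> N v. deg V E x = 3}. x = y"
      using deg_3_nbr_unique[of _ v] no_bearing by blast
    then have "card {x \<in> N v. deg V E x = 3} \<le> Suc 0"
      using card_le_Suc0_iff_eq[OF fin] by blast
    then show ?thesis by simp
  qed
  finally show ?thesis .
qed

text \<open>With every \<open>G\<close> at most 1/3, \<open>pair_bound\<close> gives 8 / d w \<le>
  2/3, so all degrees are at least 12. Then every weight is at most -2/3, against
  \<open>G_nonneg\<close>.\<close>

lemma no_adjacent_deg_2_False: False
proof -
  have ge12: "d w \<ge> 12" if w: "w \<in> V" for w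
  proof -
    have "\<exists>p q. p \<in> N w \<and> q \<in> N w \<and> p \<noteq> q"
    proof (rule ccontr)
      assume "\<not> ?thesis"
      then have "card (N w) \<le> 1" using card_le_Suc0_iff_eq[OF finite_nbrs] by auto
      then show False using deg_ge_3[OF w] by (simp add: deg_def)
    qed
    then obtain p q where "p \<in> N w" "q \<in> N w" and ne: "p \<noteq> q" by blast
    then have "w \<in> N p" "w \<in> N q" using nbrs_symD by blast+
    from pair_bound[OF this ne] have "8 / d w \<le> 2/3"
      using G_le_third[of p] G_le_third[of q] by simp
    then show ?thesis using d_pos[OF w] by (simp add: field_simps)
  qed
  obtain v where v: "v \<in> V" using card_V by fastforce
  have "G v \<le> (\<Sum>x\<in>N v. - 2/3)"
  proof (rule G_le)
    fix x assume "x \<in> N v"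
    then have "deg V E x \<ge> 12" using ge12[OF nbr_in_V(1)] by simp
    then show "4 / d x - 1 \<le> - 2/3" using weight_le[of 12 x] by simp
  qed
  also have "\<dots> = - 2/3 * d v" by (simp add: deg_def)
  also have "\<dots> < 0" using d_pos[OF v] by simp
  finally show False using G_nonneg[OF v] by simp
qed

end

context gapped_graph
begin

theorem petal_or_book: "petal_like \<or> book_like"
proof (rule ccontr)
  assume "\<not> ?thesis"
  then interpret no_adjacent_deg_2 V E
    by unfold_locales (use adjacent_deg_2 in blast)
  show False by (rule no_adjacent_deg_2_False)
qed

end

section \<open>Eigenvalues of petal and book graphs\<close>

lemma nlap_eigenvalueE:
  assumes "\<mu> \<in> nlap_eigenvalues V E"
  obtains f where "\<exists>v\<in>V. f v \<noteq> 0" "\<And>v. v \<in> V \<Longrightarrow> norm_lap V E f v = \<mu> * f v"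
proof -
  have "\<exists>f. (\<exists>v\<in>V. f v \<noteq> 0) \<and> (\<forall>v\<in>V. norm_lap V E f v = \<mu> * f v)"
    using assms by (simp add: nlap_eigenvalues_def)
  then obtain f where f: "(\<exists>v\<in>V. f v \<noteq> 0) \<and> (\<forall>v\<in>V. norm_lap V E f v = \<mu> * f v)" ..
  show thesis by (rule that[of f]) (use f in auto)
qed

context connected_graph
begin

section \<open>Finiteness of the spectrum, so that \<open>Min\<close> is a true minimum\<close>

lemma ip_sym: "ip f g = ip g f"
  by (simp add: ip_def mult_ac)

lemma ip_sum_right: "ip f (\<lambda>x. \<Sum>\<mu>\<in>B. c \<mu> * F \<mu> x) = (\<Sum>\<mu>\<in>B. c \<mu> * ip f (F \<mu>))"
proof -
  have "ip f (\<lambda>x. \<Sum>\<mu>\<in>B. c \<mu> * F \<mu> x) = (\<Sum>y\<in>V. \<Sum>\<mu>\<in>B. c \<mu> * (d y * f y * F \<mu> y))"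
    unfolding ip_def sum_distrib_left by (intro sum.cong refl) (simp add: mult_ac)
  also have "\<dots> = (\<Sum>\<mu>\<in>B. c \<mu> * ip f (F \<mu>))"
    unfolding ip_def sum_distrib_left by (rule sum.swap)
  finally show ?thesis .
qed

lemma eigenfunctions_orthogonal:
  assumes f: "\<And>v. v \<in> V \<Longrightarrow> norm_lap V E f v = \<mu> * f v"
    and g: "\<And>v. v \<in> V \<Longrightarrow> norm_lap V E g v = \<nu> * g v" and "\<mu> \<noteq> \<nu>"
  shows "ip f g = 0"
proof -
  have f': "(\<Sum>w\<in>N v. f w) = (1 - \<mu>) * d v * f v" if "v \<in> V" for v
    using f[OF that] norm_lap_eigen_iff[OF that, of f "1 - \<mu>"] by simp
  have g': "(\<Sum>w\<in>N v. g w) = (1 - \<nu>) * d v * g v" if "v \<in> V" for v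
    using g[OF that] norm_lap_eigen_iff[OF that, of g "1 - \<nu>"] by simp
  have "(1 - \<mu>) * ip f g = (\<Sum>v\<in>V. g v * (\<Sum>w\<in>N v. f w))"
    unfolding ip_def by (subst sum_distrib_left, intro sum.cong refl) (simp add: f')
  also have "\<dots> = (\<Sum>v\<in>V. f v * (\<Sum>w\<in>N v. g w))"
    by (rule sum_nbrs_swap)
  also have "\<dots> = (1 - \<nu>) * ip f g"
    unfolding ip_def by (subst sum_distrib_left, intro sum.cong refl) (simp add: g')
  finally show ?thesis using \<open>\<mu> \<noteq> \<nu>\<close> by simp
qed

text \<open>Bessel's inequality for the point masses, summed over all vertices, bounds the number of
  orthonormal eigenfunctions.\<close>

lemma finite_eigenvalues: "finite (nlap_eigenvalues V E)"
proof -
  have "\<exists>f. ip f f = 1 \<and> (\<forall>v\<in>V. norm_lap V E f v = \<mu> * f v)" if \<mu>: "\<mu> \<in> nlap_eigenvalues V E" for \<mu>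
  proof -
    obtain f where f: "\<exists>v\<in>V. f v \<noteq> 0" "\<And>v. v \<in> V \<Longrightarrow> norm_lap V E f v = \<mu> * f v"
      by (rule nlap_eigenvalueE[OF \<mu>]) (rule that)
    define c where "c = 1 / sqrt (ip f f)"
    have "ip f f > 0" using f(1) ip_zero_iff[of f] ip_nonneg[of f] by force
    then have "ip (\<lambda>x. c * f x) (\<lambda>x. c * f x) = 1"
      unfolding ip_scale by (simp add: c_def power_divide)
    moreover have "norm_lap V E (\<lambda>x. c * f x) v = \<mu> * (c * f v)" if "v \<in> V" for v
    proof -
      have "norm_lap V E (\<lambda>x. c * f x) v = c * norm_lap V E f v"
        by (simp add: norm_lap_def sum_distrib_left[symmetric] right_diff_distrib)
      then show ?thesis using f(2)[OF that] by simp
    qed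
    ultimately show ?thesis by blast
  qed
  then obtain F where F1: "\<And>\<mu>. \<mu> \<in> nlap_eigenvalues V E \<Longrightarrow> ip (F \<mu>) (F \<mu>) = 1"
    and F2: "\<And>\<mu> v. \<mu> \<in> nlap_eigenvalues V E \<Longrightarrow> v \<in> V \<Longrightarrow> norm_lap V E (F \<mu>) v = \<mu> * F \<mu> v"
    by metis
  have "card B \<le> card V" if B: "B \<subseteq> nlap_eigenvalues V E" "finite B" for B
  proof -
    have orth: "ip (F \<mu>) (F \<nu>) = (if \<mu> = \<nu> then 1 else 0)" if "\<mu> \<in> B" "\<nu> \<in> B" for \<mu> \<nu>
      using eigenfunctions_orthogonal[of "F \<mu>" \<mu> "F \<nu>" \<nu>] F1 F2 that B by auto
    \<comment> \<open>The point mass at \<open>v\<close> has squared norm \<open>d v\<close> and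
      coefficients d v F(v), so Bessel's inequality is divided by \<open>d v\<close>. Summed over
      \<open>v\<close>, the left side becomes the sum of the squared norms of the
      eigenfunctions.\<close>
    have Bessel: "(\<Sum>\<mu>\<in>B. d v * F \<mu> v * F \<mu> v) \<le> 1" if v: "v \<in> V" for v
    proof -
      define \<delta> where "\<delta> = (\<lambda>z. if z = v then 1 else 0 :: real)"
      define c where "c = (\<lambda>\<mu>. d v * F \<mu> v)"
      define s where "s = (\<lambda>x. \<Sum>\<mu>\<in>B. c \<mu> * F \<mu> x)"
      have \<delta>: "ip \<delta> g = d v * g v" for g
        using v finite_V unfolding ip_def \<delta>_def
        by (simp add: if_distrib[of "\<lambda>a. _ * a"] if_distrib[of "\<lambda>a. a * _"] cong: if_cong)
      have sF: "ip (F \<nu>) s = c \<nu>" if "\<nu> \<in> B" for \<nu>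
      proof -
        have "ip (F \<nu>) s = (\<Sum>\<mu>\<in>B. c \<mu> * ip (F \<nu>) (F \<mu>))"
          unfolding s_def by (rule ip_sum_right)
        also have "\<dots> = (\<Sum>\<mu>\<in>B. if \<nu> = \<mu> then c \<nu> else 0)"
          using orth that by (intro sum.cong refl) auto
        finally show ?thesis using that B(2) by simp
      qed
      have "ip s s = (\<Sum>\<mu>\<in>B. c \<mu> * ip s (F \<mu>))"
        unfolding s_def by (rule ip_sum_right)
      also have "\<dots> = (\<Sum>\<mu>\<in>B. c \<mu> * c \<mu>)"
        using sF ip_sym by (intro sum.cong refl) simp
      finally have ss: "ip s s = (\<Sum>\<mu>\<in>B. c \<mu> * c \<mu>)" .
      have "ip \<delta> s = (\<Sum>\<mu>\<in>B. c \<mu> * c \<mu>)"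
        unfolding s_def ip_sum_right \<delta> by (simp add: c_def)
      moreover have "ip \<delta> \<delta> = d v" unfolding \<delta> by (simp add: \<delta>_def)
      moreover have "ip \<delta> \<delta> + 2 * (- 1) * ip \<delta> s + (- 1)\<^sup>2 * ip s s \<ge> 0"
        unfolding ip_expand[symmetric] by (rule ip_nonneg)
      ultimately have "(\<Sum>\<mu>\<in>B. c \<mu> * c \<mu>) \<le> d v" using ss by simp
      moreover have "(\<Sum>\<mu>\<in>B. c \<mu> * c \<mu>) = d v * (\<Sum>\<mu>\<in>B. d v * F \<mu> v * F \<mu> v)"
        unfolding sum_distrib_left c_def by (intro sum.cong refl) (simp add: mult_ac)
      ultimately show ?thesis using d_pos[OF v] by simp
    qed
    have "real (card B) = (\<Sum>\<mu>\<in>B. ip (F \<mu>) (F \<mu>))"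
      using orth by simp
    also have "\<dots> = (\<Sum>v\<in>V. \<Sum>\<mu>\<in>B. d v * F \<mu> v * F \<mu> v)"
      unfolding ip_def by (rule sum.swap)
    also have "\<dots> \<le> (\<Sum>v\<in>V. 1)"
      using Bessel by (rule sum_mono)
    finally show ?thesis by simp
  qed
  then show ?thesis using finite_if_finite_subsets_card_bdd by blast
qed

end

section \<open>Invariance of the spectrum under isomorphism\<close>

lemma graph_iso_sym:
  assumes "graph_iso V E V' E'" shows "graph_iso V' E' V E"
proof -
  obtain h where h: "bij_betw h V V'" "\<And>u v. u \<in> V \<Longrightarrow> v \<in> V \<Longrightarrow> E u v \<longleftrightarrow> E' (h u) (h v)"
    using assms by (auto simp: graph_iso_def)
  have inv: "bij_betw (inv_into V h) V' V" using h(1) by (rule bij_betw_inv_into)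
  have "E' u v \<longleftrightarrow> E (inv_into V h u) (inv_into V h v)" if "u \<in> V'" "v \<in> V'" for u v
    using h(2)[of "inv_into V h u" "inv_into V h v"] that
      bij_betw_apply[OF inv] bij_betw_inv_into_right[OF h(1)] by simp
  then show ?thesis unfolding graph_iso_def using inv by blast
qed

text \<open>Eigenfunctions pull back along the isomorphism, which maps neighbourhoods bijectively
  onto neighbourhoods.\<close>

lemma graph_iso_eigenvalues_subset:
  assumes "graph_iso V E V' E'"
  shows "nlap_eigenvalues V' E' \<subseteq> nlap_eigenvalues V E"
proof
  fix \<mu> assume \<mu>: "\<mu> \<in> nlap_eigenvalues V' E'"
  obtain f where f: "\<exists>v\<in>V'. f v \<noteq> 0" "\<And>v. v \<in> V' \<Longrightarrow> norm_lap V' E' f v = \<mu> * f v"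
    by (rule nlap_eigenvalueE[OF \<mu>]) (rule that)
  obtain h where h: "bij_betw h V V'" "\<And>u v. u \<in> V \<Longrightarrow> v \<in> V \<Longrightarrow> E u v \<longleftrightarrow> E' (h u) (h v)"
    using assms by (auto simp: graph_iso_def)
  have V': "V' = h ` V" and inj: "inj_on h V" using h(1) by (auto simp: bij_betw_def)
  have "norm_lap V E (f \<circ> h) v = \<mu> * (f \<circ> h) v" if v: "v \<in> V" for v
  proof -
    have "nbrs V' E' (h v) = h ` nbrs V E v"
      unfolding nbrs_def V' using h(2) v by auto
    moreover have "inj_on h (nbrs V E v)"
      using inj by (rule inj_on_subset) (auto simp: nbrs_def)
    ultimately have "norm_lap V' E' f (h v) = norm_lap V E (f \<circ> h) v"
      by (simp add: norm_lap_def deg_def card_image sum.reindex)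
    then show ?thesis using f(2)[of "h v"] v V' by simp
  qed
  moreover have "\<exists>v\<in>V. (f \<circ> h) v \<noteq> 0" using f(1) V' by auto
  ultimately show "\<mu> \<in> nlap_eigenvalues V E" unfolding nlap_eigenvalues_def by blast
qed

lemma graph_iso_eigenvalues:
  assumes "graph_iso V E V' E'"
  shows "nlap_eigenvalues V E = nlap_eigenvalues V' E'"
  using graph_iso_eigenvalues_subset[OF graph_iso_sym[OF assms]] graph_iso_eigenvalues_subset[OF assms]
  by (rule equalityI)

section \<open>Explicit eigenfunctions and gaps of the two families\<close>

lemma nbrs_petal:
  "m \<ge> 1 \<Longrightarrow> nbrs (petal_V m) (petal_E m) 0 = {1..2*m}"
  "i \<in> {1..m} \<Longrightarrow> nbrs (petal_V m) (petal_E m) i = {0, m + i}"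
  "i \<in> {1..m} \<Longrightarrow> nbrs (petal_V m) (petal_E m) (m + i) = {0, i}"
  by (auto simp: nbrs_def petal_V_def petal_E_def)

lemma nbrs_book:
  "nbrs (book_V m) (book_E m) 0 = {1..m}"
  "nbrs (book_V m) (book_E m) (2*m+1) = {m+1..2*m}"
  "i \<in> {1..m} \<Longrightarrow> nbrs (book_V m) (book_E m) i = {0, m + i}"
  "i \<in> {1..m} \<Longrightarrow> nbrs (book_V m) (book_E m) (m + i) = {2*m+1, i}"
proof -
  show "nbrs (book_V m) (book_E m) (2*m+1) = {m+1..2*m}"
  proof (intro set_eqI iffI)
    fix a assume "a \<in> {m+1..2*m}"
    then have "1 \<le> a - m \<and> a - m \<le> m \<and> a = m + (a - m)" by auto
    then show "a \<in> nbrs (book_V m) (book_E m) (2*m+1)"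
      unfolding nbrs_def book_V_def book_E_def by auto
  qed (auto simp: nbrs_def book_V_def book_E_def)
qed (auto simp: nbrs_def book_V_def book_E_def)

lemma sum_two_blocks: "(\<Sum>k\<in>{m+1..2*m}. f k) = (\<Sum>i=1..m. f (m + i))"
  for f :: "nat \<Rightarrow> real"
  using sum.shift_bounds_cl_nat_ivl[of f 1 m m] by (simp add: add.commute mult_2)

lemma block_cases:
  fixes v m :: nat
  assumes "v \<in> {1..2*m}"
  obtains i where "i \<in> {1..m}" "v = i" | i where "i \<in> {1..m}" "v = m + i"
proof (cases "v \<le> m")
  case False
  then have "v - m \<in> {1..m}" "v = m + (v - m)" using assms by auto
  then show ?thesis using that(2) by blast
qed (use assms that(1) in auto)

lemma norm_lap_two:
  "nbrs V E v = {a, b} \<Longrightarrow> a \<noteq> b \<Longrightarrow> norm_lap V E f v = f v - (f a + f b) / 2"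
  by (simp add: norm_lap_def deg_def)

lemma petal_hub:
  assumes "m \<ge> 1"
  shows "norm_lap (petal_V m) (petal_E m) f 0 = f 0 - (\<Sum>i=1..m. f i + f (m + i)) / (2 * m)"
proof -
  have "{1..2*m} = {1..m} \<union> {m+1..2*m}" by auto
  then have "(\<Sum>k\<in>{1..2*m}. f k) = (\<Sum>k\<in>{1..m}. f k) + (\<Sum>k\<in>{m+1..2*m}. f k)"
    by (simp add: sum.union_disjoint)
  then show ?thesis
    unfolding norm_lap_def deg_def nbrs_petal(1)[OF assms] sum_two_blocks by (simp add: sum.distrib)
qed

lemma petal_eigenvalue: assumes "m \<ge> 1" shows "3/2 \<in> nlap_eigenvalues (petal_V m) (petal_E m)"
proof -
  \<comment> \<open>The values sum to 0 on every triangle, so each average is -1/2 times the value: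
    an M-eigenfunction for -1/2.\<close>
  define f where "f = (\<lambda>v::nat. if v = 0 then - 2 else 1 :: real)"
  have "norm_lap (petal_V m) (petal_E m) f v = 3/2 * f v" if v: "v \<in> petal_V m" for v
  proof (cases "v = 0")
    case True
    then show ?thesis using assms petal_hub[OF assms, of f] by (simp add: f_def)
  next
    case False
    then have "v \<in> {1..2*m}" using v by (auto simp: petal_V_def)
    then show ?thesis
    proof (cases rule: block_cases)
      case (1 i)
      then have "norm_lap (petal_V m) (petal_E m) f v = f i - (f 0 + f (m + i)) / 2"
        using norm_lap_two[OF nbrs_petal(2)[OF 1(1)], of f] by simp
      then show ?thesis using 1 by (simp add: f_def)
    next
      case (2 i)
      then have "norm_lap (petal_V m) (petal_E m) f v = f (m + i) - (f 0 + f i) / 2"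
        using norm_lap_two[OF nbrs_petal(3)[OF 2(1)], of f] by simp
      then show ?thesis using 2 by (simp add: f_def)
    qed
  qed
  moreover have "0 \<in> petal_V m" by (simp add: petal_V_def)
  moreover have "f 0 \<noteq> 0" by (simp add: f_def)
  ultimately show ?thesis unfolding nlap_eigenvalues_def by blast
qed

lemma petal_gap:
  assumes m: "m \<ge> 1" and "\<nu> \<in> nlap_eigenvalues (petal_V m) (petal_E m)"
  shows "\<bar>1 - \<nu>\<bar> \<ge> 1/2"
proof (rule ccontr)
  define \<mu> where "\<mu> = 1 - \<nu>"
  assume "\<not> ?thesis"
  then have small: "- 1/2 < \<mu>" "\<mu> < 1/2" unfolding \<mu>_def by linarith+
  obtain f where f: "\<exists>v\<in>petal_V m. f v \<noteq> 0"
    "\<And>v. v \<in> petal_V m \<Longrightarrow> norm_lap (petal_V m) (petal_E m) f v = \<nu> * f v"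
    by (rule nlap_eigenvalueE[OF assms(2)]) (rule that)
  have page: "f (m + i) = f i" "(2 * \<mu> - 1) * f i = f 0" if i: "i \<in> {1..m}" for i
  proof -
    have "i \<in> petal_V m" "m + i \<in> petal_V m" using i by (auto simp: petal_V_def)
    then have "f i - (f 0 + f (m + i)) / 2 = \<nu> * f i" "f (m + i) - (f 0 + f i) / 2 = \<nu> * f (m + i)"
      using f(2) norm_lap_two[OF nbrs_petal(2)[OF i], of f] norm_lap_two[OF nbrs_petal(3)[OF i], of f] i
      by auto
    then have e: "f 0 + f (m + i) = 2 * \<mu> * f i" "f 0 + f i = 2 * \<mu> * f (m + i)"
      by (simp_all add: \<mu>_def field_simps)
    then have "(2 * \<mu> + 1) * (f (m + i) - f i) = 0" by (simp add: algebra_simps)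
    then show "f (m + i) = f i" using small by simp
    then show "(2 * \<mu> - 1) * f i = f 0" using e by (simp add: algebra_simps)
  qed
  have "(\<Sum>i=1..m. f i + f (m + i)) = (\<Sum>i=1..m. 2 * f i)"
    using page(1) by (intro sum.cong refl) auto
  moreover have "0 \<in> petal_V m" by (simp add: petal_V_def)
  then have "(\<Sum>i=1..m. f i + f (m + i)) = 2 * m * (\<mu> * f 0)"
    using f(2)[of 0] petal_hub[OF m, of f] m by (simp add: \<mu>_def field_simps)
  ultimately have total: "2 * m * (\<mu> * f 0) = (\<Sum>i=1..m. 2 * f i)"
    by simp
  \<comment> \<open>The factor 2 \<mu> - 1 turns every outer value into \<open>f 0\<close>. What
    remains is the factor 2 \<mu>^2 - \<mu> - 1, with roots -1/2 and 1.\<close>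
  have "(2 * \<mu> - 1) * (2 * m * (\<mu> * f 0)) = (\<Sum>i=1..m. (2 * \<mu> - 1) * (2 * f i))"
    unfolding total by (rule sum_distrib_left)
  also have "\<dots> = (\<Sum>i=1..m. 2 * f 0)"
    using page(2) by (intro sum.cong refl) (simp add: mult.left_commute)
  finally have "2 * m * ((2 * \<mu> + 1) * (\<mu> - 1) * f 0) = 0"
    by (simp add: algebra_simps)
  then have "f 0 = 0" using m small by simp
  then have "f i = 0" "f (m + i) = 0" if "i \<in> {1..m}" for i
    using page[OF that] small by auto
  then have "f v = 0" if "v \<in> petal_V m" for v
  proof (cases "v = 0")
    case False
    then have "v \<in> {1..2*m}" using that by (auto simp: petal_V_def)
    then show ?thesis by (cases rule: block_cases) (use \<open>\<And>i. i \<in> {1..m} \<Longrightarrow> f i = 0\<close> \<open>\<And>i. i \<in> {1..m} \<Longrightarrow> f (m + i) = 0\<close> in auto)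
  qed (use \<open>f 0 = 0\<close> in simp)
  then show False using f(1) by blast
qed

lemma book_hubs:
  "norm_lap (book_V m) (book_E m) f 0 = f 0 - (\<Sum>i=1..m. f i) / m"
  "norm_lap (book_V m) (book_E m) f (2*m+1) = f (2*m+1) - (\<Sum>i=1..m. f (m + i)) / m"
  unfolding norm_lap_def deg_def nbrs_book sum_two_blocks by simp_all

lemma book_cases:
  assumes "v \<in> book_V m"
  obtains "v = 0" | "v = 2*m+1" | i where "i \<in> {1..m}" "v = i" | i where "i \<in> {1..m}" "v = m + i"
proof (cases "v = 0 \<or> v = 2*m+1")
  case False
  then have "v \<in> {1..2*m}" using assms by (auto simp: book_V_def)
  then show ?thesis by (cases rule: block_cases) (use that in auto)
qed (use that in auto)

lemma book_eigenvalue: assumes "m \<ge> 1" shows "3/2 \<in> nlap_eigenvalues (book_V m) (book_E m)"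
proof -
  define f where "f = (\<lambda>v::nat. if v = 0 \<or> v = 2*m+1 then - 2 else 1 :: real)"
  have fi: "f i = 1" "f (m + i) = 1" if "i \<in> {1..m}" for i
    using that by (auto simp: f_def)
  have hub: "f 0 = - 2" "f (2*m+1) = - 2" by (auto simp: f_def)
  have "norm_lap (book_V m) (book_E m) f v = 3/2 * f v" if v: "v \<in> book_V m" for v
    using v
  proof (cases rule: book_cases)
    case 1
    show ?thesis unfolding 1 book_hubs using assms hub fi by simp
  next
    case 2
    show ?thesis unfolding 2 book_hubs using assms hub fi by simp
  next
    case (3 i)
    then have "norm_lap (book_V m) (book_E m) f v = f i - (f 0 + f (m + i)) / 2"
      using norm_lap_two[OF nbrs_book(3)[OF 3(1)], of f] by simp
    then show ?thesis using 3 fi hub by simp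
  next
    case (4 i)
    then have "norm_lap (book_V m) (book_E m) f v = f (m + i) - (f (2*m+1) + f i) / 2"
      using norm_lap_two[OF nbrs_book(4)[OF 4(1)], of f] by simp
    then show ?thesis using 4 fi hub by simp
  qed
  moreover have "0 \<in> book_V m" by (simp add: book_V_def)
  moreover have "f 0 \<noteq> 0" by (simp add: f_def)
  ultimately show ?thesis unfolding nlap_eigenvalues_def by blast
qed

text \<open>Exchanging the two hubs splits an eigenfunction into a symmetric and an antisymmetric
  part, and the equations for sums and differences decouple. The factors (2 \<mu> + 1)(\<mu> - 1)
  and (2 \<mu> - 1)(\<mu> + 1) have no root strictly between -1/2 and 1/2.\<close>

lemma book_gap:
  assumes m: "m \<ge> 1" and "\<nu> \<in> nlap_eigenvalues (book_V m) (book_E m)"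
  shows "\<bar>1 - \<nu>\<bar> \<ge> 1/2"
proof (rule ccontr)
  define \<mu> where "\<mu> = 1 - \<nu>"
  assume "\<not> ?thesis"
  then have small: "- 1/2 < \<mu>" "\<mu> < 1/2" unfolding \<mu>_def by linarith+
  obtain f where f: "\<exists>v\<in>book_V m. f v \<noteq> 0"
    "\<And>v. v \<in> book_V m \<Longrightarrow> norm_lap (book_V m) (book_E m) f v = \<nu> * f v"
    by (rule nlap_eigenvalueE[OF assms(2)]) (rule that)
  define y where "y = f (2*m+1)"
  have page: "(2 * \<mu> - 1) * (f i + f (m + i)) = f 0 + y" "(2 * \<mu> + 1) * (f i - f (m + i)) = f 0 - y"
    if i: "i \<in> {1..m}" for i
  proof -
    have "i \<in> book_V m" "m + i \<in> book_V m" using i by (auto simp: book_V_def)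
    then have "f i - (f 0 + f (m + i)) / 2 = \<nu> * f i" "f (m + i) - (y + f i) / 2 = \<nu> * f (m + i)"
      using f(2) norm_lap_two[OF nbrs_book(3)[OF i], of f] norm_lap_two[OF nbrs_book(4)[OF i], of f] i
      by (auto simp: y_def)
    then have "f 0 + f (m + i) = 2 * \<mu> * f i" "y + f i = 2 * \<mu> * f (m + i)"
      by (simp_all add: \<mu>_def field_simps)
    then show "(2 * \<mu> - 1) * (f i + f (m + i)) = f 0 + y" "(2 * \<mu> + 1) * (f i - f (m + i)) = f 0 - y"
      by (simp_all add: algebra_simps)
  qed
  have "0 \<in> book_V m" "2*m+1 \<in> book_V m" by (simp_all add: book_V_def)
  then have hubs: "(\<Sum>i=1..m. f i) = m * (\<mu> * f 0)" "(\<Sum>i=1..m. f (m + i)) = m * (\<mu> * y)"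
    using f(2)[of 0] f(2)[of "2*m+1"] book_hubs[of m f] m by (simp_all add: \<mu>_def y_def field_simps)
  have "(2 * \<mu> - 1) * (m * (\<mu> * (f 0 + y))) = (\<Sum>i=1..m. (2 * \<mu> - 1) * (f i + f (m + i)))"
    unfolding sum_distrib_left[symmetric] sum.distrib hubs by (simp add: algebra_simps)
  also have "\<dots> = (\<Sum>i=1..m. f 0 + y)"
    using page(1) by (intro sum.cong refl) simp
  finally have "m * ((2 * \<mu> + 1) * (\<mu> - 1) * (f 0 + y)) = 0"
    by (simp add: algebra_simps)
  then have S: "f 0 + y = 0" using m small by simp
  have "(2 * \<mu> + 1) * (m * (\<mu> * (f 0 - y))) = (\<Sum>i=1..m. (2 * \<mu> + 1) * (f i - f (m + i)))"
    unfolding sum_distrib_left[symmetric] sum_subtractf hubs by (simp add: algebra_simps)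
  also have "\<dots> = (\<Sum>i=1..m. f 0 - y)"
    using page(2) by (intro sum.cong refl) simp
  finally have "m * ((2 * \<mu> - 1) * (\<mu> + 1) * (f 0 - y)) = 0"
    by (simp add: algebra_simps)
  then have T: "f 0 - y = 0" using m small by simp
  have hub0: "f 0 = 0" "y = 0" using S T by auto
  have zero: "f i = 0" "f (m + i) = 0" if "i \<in> {1..m}" for i
  proof -
    have "f i + f (m + i) = 0" "f i - f (m + i) = 0"
      using page[OF that] S T small by auto
    then show "f i = 0" "f (m + i) = 0" by auto
  qed
  have "f v = 0" if "v \<in> book_V m" for v
    using that by (cases rule: book_cases) (use zero hub0 in \<open>auto simp: y_def\<close>)
  then show False using f(1) by blast
qed

section \<open>Isomorphism with petal and book graphs\<close>

context gapped_graph
begin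

lemma petal_like_iso:
  assumes petal_like
  shows "\<exists>m\<ge>1. graph_iso V E (petal_V m) (petal_E m)"
proof -
  obtain w where w: "w \<in> V" "V = insert w (N w)" and deg2: "\<And>v. v \<in> N w \<Longrightarrow> deg V E v = 2"
    using assms by (auto simp: petal_like_def)
  have "\<exists>x. N v = {w, x} \<and> w \<noteq> x" if "v \<in> N w" for v
    using nbrs_deg_2[OF deg2[OF that] nbrs_symD[OF that]] by metis
  then obtain \<sigma> where \<sigma>: "\<And>v. v \<in> N w \<Longrightarrow> N v = {w, \<sigma> v}" "\<And>v. v \<in> N w \<Longrightarrow> w \<noteq> \<sigma> v"
    by metis
  have \<sigma>N: "\<sigma> v \<in> N w" if "v \<in> N w" for v
    using \<sigma>[OF that] w(2) nbr_in_V(1)[of "\<sigma> v" v] by auto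
  have \<sigma>\<sigma>: "\<sigma> (\<sigma> v) = v" if "v \<in> N w" for v
  proof -
    have "\<sigma> v \<in> N v" using \<sigma>(1)[OF that] by simp
    then have "v \<in> {w, \<sigma> (\<sigma> v)}" using nbrs_symD \<sigma>(1)[OF \<sigma>N[OF that]] by blast
    then show ?thesis using that not_self_nbr by auto
  qed
  have \<sigma>ne: "\<sigma> v \<noteq> v" if "v \<in> N w" for v
    using \<sigma>(1)[OF that] not_self_nbr by (metis insertCI)
  \<comment> \<open>Nothing distinguishes the two outer vertices of a petal, so an arbitrary
    injection into the naturals orders them; \<open>A\<close> takes the smaller one of each
    pair.\<close>
  obtain g :: "'a \<Rightarrow> nat" where g: "inj_on g V"
    using finite_imp_inj_to_nat_seg[OF finite_V] by blast
  define A where "A = {v \<in> N w. g v < g (\<sigma> v)}"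
  define B where "B = N w - A"
  define m where "m = card A"
  have AN: "a \<in> N w" if "a \<in> A" for a using that by (simp add: A_def)
  have BN: "b \<in> N w" if "b \<in> B" for b using that by (simp add: B_def)
  have AB: "\<sigma> a \<in> B" if "a \<in> A" for a
    using that \<sigma>N \<sigma>\<sigma> by (auto simp: A_def B_def)
  have BA: "\<sigma> b \<in> A" if "b \<in> B" for b
  proof -
    have b: "b \<in> N w" "\<not> g b < g (\<sigma> b)" using that by (auto simp: A_def B_def)
    moreover have "g b \<noteq> g (\<sigma> b)"
      using g \<sigma>ne[OF b(1)] b(1) \<sigma>N[OF b(1)] nbr_in_V(1) by (metis inj_onD)
    ultimately show ?thesis using \<sigma>N[OF b(1)] \<sigma>\<sigma>[OF b(1)] by (auto simp: A_def)
  qed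
  have finA: "finite A" using finite_nbrs by (simp add: A_def)
  then obtain e where e: "bij_betw e A {1..m}"
    unfolding m_def using ex_bij_betw_finite_nat[OF finA]
    by (metis bij_betw_iff_card card_atLeastAtMost diff_Suc_1 finA finite_atLeastAtMost)
  define h where "h = (\<lambda>x. if x = w then 0 else if x \<in> A then e x else m + e (\<sigma> x))"
  have hw: "h w = 0" by (simp add: h_def)
  have hA: "h a = e a" if "a \<in> A" for a
    using AN[OF that] that not_self_nbr by (auto simp: h_def)
  have hB: "h b = m + e (\<sigma> b)" if "b \<in> B" for b
    using BN[OF that] that not_self_nbr by (auto simp: h_def B_def)
  have eA: "1 \<le> e a" "e a \<le> m" if "a \<in> A" for a
    using bij_betw_apply[OF e that] by auto
  have inj_e: "e a = e a' \<longleftrightarrow> a = a'" if "a \<in> A" "a' \<in> A" for a a'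
    using e that by (auto simp: bij_betw_def inj_on_def)
  have \<sigma>_bij: "bij_betw \<sigma> B A"
    by (rule bij_betw_byWitness[of B \<sigma> \<sigma> A]) (use AB BA \<sigma>\<sigma> AN BN in auto)
  have bij: "bij_betw h V (petal_V m)"
  proof -
    have "bij_betw h {w} {0}" using hw by (simp add: bij_betw_def)
    moreover have "bij_betw h A {1..m}"
      using e by (rule bij_betw_cong[THEN iffD2, rotated]) (simp add: hA)
    moreover have "bij_betw h B {m+1..2*m}"
    proof -
      have "bij_betw ((+) m) {1..m} {m+1..2*m}"
        by (simp add: bij_betw_def image_add_atLeastAtMost mult_2)
      then have "bij_betw ((+) m \<circ> (e \<circ> \<sigma>)) B {m+1..2*m}"
        using bij_betw_trans[OF bij_betw_trans[OF \<sigma>_bij e]] by blast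
      then show ?thesis by (rule bij_betw_cong[THEN iffD2, rotated]) (simp add: hB)
    qed
    ultimately have "bij_betw h (({w} \<union> A) \<union> B) (({0} \<union> {1..m}) \<union> {m+1..2*m})"
      by (intro bij_betw_combine) auto
    moreover have "({w} \<union> A) \<union> B = V" using w(2) by (auto simp: A_def B_def)
    moreover have "({0} \<union> {1..m}) \<union> {m+1..2*m} = petal_V m" by (auto simp: petal_V_def)
    ultimately show ?thesis by simp
  qed
  have edges: "E u v \<longleftrightarrow> petal_E m (h u) (h v)" if uv: "u \<in> V" "v \<in> V" for u v
  proof -
    have cases: "x = w \<or> x \<in> A \<or> x \<in> B" if "x \<in> V" for x
      using that w(2) by (auto simp: B_def)
    have ww: "\<not> E w w" using mem_nbrs not_self_nbr by blast
    have wN: "E w x \<and> E x w" if "x \<in> A \<or> x \<in> B" for x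
      using that AN BN mem_nbrs nbrs_symD by blast
    have AA: "\<not> E a a'" if "a \<in> A" "a' \<in> A" for a a'
      using \<sigma>(1)[OF AN[OF that(1)]] AB[OF that(1)] AN[OF that(2)] that not_self_nbr[of w]
      by (auto simp: mem_nbrs[symmetric] B_def)
    have BB: "\<not> E b b'" if "b \<in> B" "b' \<in> B" for b b'
      using \<sigma>(1)[OF BN[OF that(1)]] BA[OF that(1)] BN[OF that(2)] that not_self_nbr[of w]
      by (auto simp: mem_nbrs[symmetric] B_def)
    have EAB: "E a b \<longleftrightarrow> e a = e (\<sigma> b)" if "a \<in> A" "b \<in> B" for a b
    proof -
      have "E a b \<longleftrightarrow> b = \<sigma> a"
        using \<sigma>(1)[OF AN[OF that(1)]] BN[OF that(2)] not_self_nbr[of w] by (auto simp: mem_nbrs[symmetric])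
      also have "\<dots> \<longleftrightarrow> a = \<sigma> b" using \<sigma>\<sigma> AN BN that by metis
      finally show ?thesis using inj_e[OF that(1) BA[OF that(2)]] by simp
    qed
    have EBA: "E b a \<longleftrightarrow> e a = e (\<sigma> b)" if "a \<in> A" "b \<in> B" for a b
      using EAB[OF that] simple by (auto simp: simple_graph_def)
    consider "u = w" "v = w" | "u = w" "v \<in> A" | "u = w" "v \<in> B"
      | "u \<in> A" "v = w" | "u \<in> A" "v \<in> A" | "u \<in> A" "v \<in> B"
      | "u \<in> B" "v = w" | "u \<in> B" "v \<in> A" | "u \<in> B" "v \<in> B"
      using cases[OF uv(1)] cases[OF uv(2)] by blast
    then show ?thesis
    proof cases
      case 1 then show ?thesis using ww by (simp add: hw petal_E_def)
    next
      case 2 then show ?thesis using wN[of v] eA[of v] by (simp add: hw hA petal_E_def)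
    next
      case 3 then show ?thesis using wN[of v] eA[OF BA[of v]] by (simp add: hw hB petal_E_def)
    next
      case 4 then show ?thesis using wN[of u] eA[of u] by (simp add: hw hA petal_E_def)
    next
      case 5 then show ?thesis using AA[of u v] eA[of u] eA[of v] by (auto simp: hA petal_E_def)
    next
      case 6 then show ?thesis
        using EAB[of u v] eA[of u] eA[OF BA[of v]] by (auto simp: hA hB petal_E_def)
    next
      case 7 then show ?thesis using wN[of u] eA[OF BA[of u]] by (simp add: hw hB petal_E_def)
    next
      case 8 then show ?thesis
        using EBA[of v u] eA[of v] eA[OF BA[of u]] by (auto simp: hA hB petal_E_def)
    next
      case 9 then show ?thesis
        using BB[of u v] eA[OF BA[of u]] eA[OF BA[of v]] by (auto simp: hB petal_E_def)
    qed
  qed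
  have "m \<ge> 1"
  proof -
    have "N w \<noteq> {}" using deg_ge_1[OF w(1)] by (auto simp: deg_def)
    then obtain v where "v \<in> N w" by blast
    then have "v \<in> A \<or> \<sigma> v \<in> A" using BA by (auto simp: B_def)
    then show ?thesis using finA card_gt_0_iff[of A] by (auto simp: m_def Suc_le_eq)
  qed
  then show ?thesis unfolding graph_iso_def using bij edges by blast
qed

text \<open>The hubs separate the two sides of the book, so the sides are \<open>N w\<close> and
  \<open>N z\<close> and the other-neighbour maps \<open>\<tau>\<close> and \<open>\<sigma>\<close>
  between them are mutually inverse.\<close>

lemma book_like_iso:
  assumes book_like
  shows "\<exists>m\<ge>1. graph_iso V E (book_V m) (book_E m)"
proof -
  obtain w z where V: "w \<in> V" "z \<in> V" "w \<noteq> z" "z \<notin> N w" "N w \<inter> N z = {}" "V = {w, z} \<union> N w \<union> N z"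
    and pw: "\<And>v. v \<in> N w \<Longrightarrow> \<exists>x\<in>N z. N v = {w, x}"
    and pz: "\<And>x. x \<in> N z \<Longrightarrow> \<exists>v\<in>N w. N x = {z, v}"
    using assms by (auto simp: book_like_def)
  define A where "A = N w"
  define B where "B = N z"
  define m where "m = card A"
  have wz: "w \<notin> A" "w \<notin> B" "z \<notin> A" "z \<notin> B"
    using V nbrs_symD not_self_nbr by (auto simp: A_def B_def)
  have disj: "A \<inter> B = {}" using V by (simp add: A_def B_def)
  obtain \<tau> where \<tau>: "\<And>a. a \<in> A \<Longrightarrow> \<tau> a \<in> B" "\<And>a. a \<in> A \<Longrightarrow> N a = {w, \<tau> a}"
    using pw unfolding A_def B_def by metis
  obtain \<sigma> where \<sigma>: "\<And>b. b \<in> B \<Longrightarrow> \<sigma> b \<in> A" "\<And>b. b \<in> B \<Longrightarrow> N b = {z, \<sigma> b}"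
    using pz unfolding A_def B_def by metis
  have \<sigma>\<tau>: "\<sigma> (\<tau> a) = a" if "a \<in> A" for a
  proof -
    have "a \<in> N (\<tau> a)" using \<tau>(2)[OF that] nbrs_symD by blast
    then show ?thesis using \<sigma>(2)[OF \<tau>(1)[OF that]] that wz by auto
  qed
  have \<tau>\<sigma>: "\<tau> (\<sigma> b) = b" if "b \<in> B" for b
  proof -
    have "b \<in> N (\<sigma> b)" using \<sigma>(2)[OF that] nbrs_symD by blast
    then show ?thesis using \<tau>(2)[OF \<sigma>(1)[OF that]] that wz by auto
  qed
  have finA: "finite A" using finite_nbrs by (simp add: A_def)
  then obtain e where e: "bij_betw e A {1..m}"
    unfolding m_def using ex_bij_betw_finite_nat[OF finA]
    by (metis bij_betw_iff_card card_atLeastAtMost diff_Suc_1 finA finite_atLeastAtMost)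
  define h where "h = (\<lambda>x. if x = w then 0 else if x = z then 2*m+1 else if x \<in> A then e x else m + e (\<sigma> x))"
  have hw: "h w = 0" and hz: "h z = 2*m+1" using V(3) by (auto simp: h_def)
  have hA: "h a = e a" if "a \<in> A" for a
    using that wz by (auto simp: h_def)
  have hB: "h b = m + e (\<sigma> b)" if "b \<in> B" for b
    using that wz disj by (auto simp: h_def)
  have eA: "1 \<le> e a" "e a \<le> m" if "a \<in> A" for a
    using bij_betw_apply[OF e that] by auto
  have inj_e: "e a = e a' \<longleftrightarrow> a = a'" if "a \<in> A" "a' \<in> A" for a a'
    using e that by (auto simp: bij_betw_def inj_on_def)
  have \<sigma>_bij: "bij_betw \<sigma> B A"
    by (rule bij_betw_byWitness[of B \<tau> \<sigma> A]) (use \<sigma> \<tau> \<sigma>\<tau> \<tau>\<sigma> in auto)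
  have bij: "bij_betw h V (book_V m)"
  proof -
    have "bij_betw h {w} {0}" using hw by (simp add: bij_betw_def)
    moreover have "bij_betw h A {1..m}"
      using e by (rule bij_betw_cong[THEN iffD2, rotated]) (simp add: hA)
    moreover have "bij_betw h B {m+1..2*m}"
    proof -
      have "bij_betw ((+) m) {1..m} {m+1..2*m}"
        by (simp add: bij_betw_def image_add_atLeastAtMost mult_2)
      then have "bij_betw ((+) m \<circ> (e \<circ> \<sigma>)) B {m+1..2*m}"
        using bij_betw_trans[OF bij_betw_trans[OF \<sigma>_bij e]] by blast
      then show ?thesis by (rule bij_betw_cong[THEN iffD2, rotated]) (simp add: hB)
    qed
    moreover have "bij_betw h {z} {2*m+1}" using hz by (simp add: bij_betw_def)
    ultimately have "bij_betw h ((({w} \<union> A) \<union> B) \<union> {z}) ((({0} \<union> {1..m}) \<union> {m+1..2*m}) \<union> {2*m+1})"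
      by (intro bij_betw_combine) auto
    moreover have "(({w} \<union> A) \<union> B) \<union> {z} = V" using V(6) by (auto simp: A_def B_def)
    moreover have "(({0} \<union> {1..m}) \<union> {m+1..2*m}) \<union> {2*m+1} = book_V m" by (auto simp: book_V_def)
    ultimately show ?thesis by simp
  qed
  have sym: "E a b \<Longrightarrow> E b a" for a b using simple by (auto simp: simple_graph_def)
  have sym': "book_E m i j \<Longrightarrow> book_E m j i" for i j unfolding book_E_def by blast
  have E_iff: "E a b \<longleftrightarrow> b \<in> N a" for a b by (simp add: mem_nbrs)
  have ww: "E w v \<longleftrightarrow> book_E m (h w) (h v)" if "v \<in> V" for v
  proof -
    consider "v = w" | "v = z" | "v \<in> A" | "v \<in> B" using \<open>v \<in> V\<close> V(6) by (auto simp: A_def B_def)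
    then show ?thesis
    proof cases
      case 1 then show ?thesis using not_self_nbr by (auto simp: E_iff hw book_E_def)
    next
      case 2 then show ?thesis using V(4) by (auto simp: E_iff hw hz book_E_def)
    next
      case 3 then show ?thesis using eA[of v] by (auto simp: E_iff hw hA book_E_def A_def[symmetric])
    next
      case 4 then show ?thesis
        using eA[OF \<sigma>(1)[of v]] disj by (auto simp: E_iff hw hB book_E_def A_def[symmetric])
    qed
  qed
  have zz: "E z v \<longleftrightarrow> book_E m (h z) (h v)" if v: "v \<in> V" "v \<noteq> w" for v
  proof -
    consider "v = z" | "v \<in> A" | "v \<in> B" using v V(6) by (auto simp: A_def B_def)
    then show ?thesis
    proof cases
      case 1 then show ?thesis using not_self_nbr by (auto simp: E_iff hz book_E_def)
    next
      case 2 then show ?thesis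
        using eA[of v] disj by (auto simp: E_iff hz hA book_E_def B_def[symmetric])
    next
      case 3 then show ?thesis
        using eA[OF \<sigma>(1)[of v]] by (auto simp: E_iff hz hB book_E_def B_def[symmetric])
    qed
  qed
  have AA: "E a a' \<longleftrightarrow> book_E m (h a) (h a')" if "a \<in> A" "a' \<in> A" for a a'
    using that \<tau>[OF that(1)] disj wz eA[OF that(1)] eA[OF that(2)] by (auto simp: E_iff hA book_E_def)
  have BB: "E b b' \<longleftrightarrow> book_E m (h b) (h b')" if "b \<in> B" "b' \<in> B" for b b'
    using that \<sigma>[OF that(1)] disj wz eA[OF \<sigma>(1)[OF that(1)]] eA[OF \<sigma>(1)[OF that(2)]]
    by (auto simp: E_iff hB book_E_def)
  have AB: "E a b \<longleftrightarrow> book_E m (h a) (h b)" if "a \<in> A" "b \<in> B" for a b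
  proof -
    have "E a b \<longleftrightarrow> b = \<tau> a" using \<tau>(2)[OF that(1)] that wz by (auto simp: E_iff)
    also have "\<dots> \<longleftrightarrow> a = \<sigma> b" using \<sigma>\<tau> \<tau>\<sigma> that by metis
    also have "\<dots> \<longleftrightarrow> e a = e (\<sigma> b)" using inj_e[OF that(1) \<sigma>(1)[OF that(2)]] by simp
    also have "\<dots> \<longleftrightarrow> book_E m (h a) (h b)"
      using that eA[OF that(1)] eA[OF \<sigma>(1)[OF that(2)]] by (auto simp: hA hB book_E_def)
    finally show ?thesis .
  qed
  have edges: "E u v \<longleftrightarrow> book_E m (h u) (h v)" if uv: "u \<in> V" "v \<in> V" for u v
  proof -
    have cases: "x = w \<or> x = z \<or> x \<in> A \<or> x \<in> B" if "x \<in> V" for x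
      using that V(6) by (auto simp: A_def B_def)
    \<comment> \<open>Both edge relations are symmetric, which reduces the mixed cases to those
      already shown.\<close>
    have flip: ?thesis if "E v u \<longleftrightarrow> book_E m (h v) (h u)"
      using that sym sym' by blast
    consider "u = w" | "v = w" | "u = z" "v \<noteq> w" | "v = z" "u \<noteq> w"
      | "u \<in> A" "v \<in> A" | "u \<in> A" "v \<in> B" | "u \<in> B" "v \<in> A" | "u \<in> B" "v \<in> B"
      using cases[OF uv(1)] cases[OF uv(2)] by blast
    then show ?thesis
    proof cases
      case 1 then show ?thesis using ww uv by blast
    next
      case 2 then show ?thesis using ww uv flip by blast
    next
      case 3 then show ?thesis using zz uv by blast
    next
      case 4 then show ?thesis using zz uv flip by blast
    next
      case 5 then show ?thesis by (rule AA)
    next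
      case 6 then show ?thesis by (rule AB)
    next
      case 7 then show ?thesis using AB flip by blast
    next
      case 8 then show ?thesis by (rule BB)
    qed
  qed
  have "A \<noteq> {}" using deg_ge_1[OF V(1)] by (auto simp: deg_def A_def)
  then have "m \<ge> 1" using finA card_gt_0_iff[of A] by (simp add: m_def Suc_le_eq)
  then show ?thesis unfolding graph_iso_def using bij edges by blast
qed

end

context connected_graph
begin

text \<open>The weak inequality serves both claims of the theorem: petal and book graphs have the
  value exactly 1/2, so no graph exceeds it.\<close>

lemma epsilon_ge_half_imp:
  assumes "nlap_epsilon V E \<ge> 1/2"
  shows "(\<exists>m\<ge>1. graph_iso V E (petal_V m) (petal_E m)) \<or> (\<exists>m\<ge>1. graph_iso V E (book_V m) (book_E m))"
proof -
  have "\<bar>1 - \<nu>\<bar> \<ge> 1/2" if "\<nu> \<in> nlap_eigenvalues V E" for \<nu>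
  proof -
    have "nlap_epsilon V E \<le> \<bar>1 - \<nu>\<bar>"
      unfolding nlap_epsilon_def using finite_eigenvalues that by (intro Min_le) auto
    then show ?thesis using assms by simp
  qed
  then interpret gapped_graph V E
    by unfold_locales (rule spectral_gap_form_nonneg)
  show ?thesis
    using petal_or_book petal_like_iso book_like_iso by blast
qed

lemma epsilon_eq_half:
  assumes "\<And>\<nu>. \<nu> \<in> nlap_eigenvalues V E \<Longrightarrow> \<bar>1 - \<nu>\<bar> \<ge> 1/2" and "3/2 \<in> nlap_eigenvalues V E"
  shows "nlap_epsilon V E = 1/2"
  unfolding nlap_epsilon_def
proof (rule Min_eqI)
  show "1/2 \<in> (\<lambda>\<mu>. \<bar>1 - \<mu>\<bar>) ` nlap_eigenvalues V E"
    using assms(2) by (rule rev_image_eqI) simp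
qed (use finite_eigenvalues assms(1) in auto)

lemma petal_or_book_epsilon:
  assumes "(\<exists>m\<ge>1. graph_iso V E (petal_V m) (petal_E m)) \<or> (\<exists>m\<ge>1. graph_iso V E (book_V m) (book_E m))"
  shows "nlap_epsilon V E = 1/2"
  using assms
proof (elim disjE exE conjE)
  fix m assume "m \<ge> 1" "graph_iso V E (petal_V m) (petal_E m)"
  then show ?thesis
    using petal_gap petal_eigenvalue by (intro epsilon_eq_half) (auto simp: graph_iso_eigenvalues)
next
  fix m assume "m \<ge> 1" "graph_iso V E (book_V m) (book_E m)"
  then show ?thesis
    using book_gap book_eigenvalue by (intro epsilon_eq_half) (auto simp: graph_iso_eigenvalues)
qed

end

theorem mainTheorem1:
  fixes V :: "'a set" and E :: "'a \<Rightarrow> 'a \<Rightarrow> bool"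
  assumes "simple_graph V E" and "graph_connected V E" and "card V \<ge> 3"
  shows "nlap_epsilon V E \<le> 1/2 \<and>
    (nlap_epsilon V E = 1/2 \<longleftrightarrow>
      (\<exists>m\<ge>1. graph_iso V E (petal_V m) (petal_E m)) \<or>
      (\<exists>m\<ge>1. graph_iso V E (book_V m) (book_E m)))"
proof -
  interpret connected_graph V E
    using assms by unfold_locales
  show ?thesis
    using epsilon_ge_half_imp petal_or_book_epsilon
    by (metis linorder_linear order_refl)
qed

end
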